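(* Let $X\subset\mathbb{C}^d$ be compact, let $(T_i,w_i)_{i\in\mathcal I}$ be a $C^\omega$ map-weight system on $X$, and suppose that the Euclidean ball $D\subset\mathbb{C}^d$ is an admissible domain for $(T_i,w_i)_{i\in\mathcal I}$. Suppose that $\bigcup_{i\in\mathcal I}T_i(D)$ is contained in the ball concentric with $D$ whose radius is $r<1$ times that of $D$ (where $0<r<1$). Set $W:=\sup_{z\in D}\sum_{i\in\mathcal I}|w_i(z)|$. Let $\mathcal L_{U(D)}:U(D)\to U(D)$, $\mathcal L_{U(D)}f=\sum_{i\in\mathcal I}w_i\cdot f\circ T_i$, be the associated transfer operator on $U(D)$, with eigenvalue sequence $\{\lambda_n(\mathcal L_{U(D)})\}_{n=1}^\infty$ (the Ruelle eigenvalue sequence). Then $$|\lambda_n(\mathcal L_{U(D)})| < \frac{W}{r^d}\, n^{1/2}\, r^{\frac{d}{d+1}(d!)^{1/d}n^{1/d}}\quad\text{for all } n\ge 1.$$ If $d=1$ then $$|\lambda_n(\mathcal L_{U(D)})|\le W\, n^{1/2}\, r^{(n-1)/2}\quad\text{for all } n\ge 1.$$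
   Context: $\mathbb{C}^d$ carries the Euclidean norm. A domain is a non-empty connected open set; $\mathcal D_d$ is the set of bounded domains in $\mathbb{C}^d$. For bounded sets, $\Delta_1\subset\subset\Delta_2$ means $\overline{\Delta_1}\subset\Delta_2$. For $D\in\mathcal D_d$ and a Banach space $B$, $U(D,B)$ is the Banach space of continuous functions $\overline D\to B$ that are holomorphic on $D$, with the supremum norm over $\overline D$; $U(D)=U(D,\mathbb{C})$. Let $\mathcal I$ be a non-empty countable set. A holomorphic map system on $D\in\mathcal D_d$ is a family $(T_i)_{i\in\mathcal I}$ with $T_i\in U(D,\mathbb{C}^d)$ and $\bigcup_{i}T_i(D)\subset\subset D$. A holomorphic weight system on $D$ is a family $(w_i)_{i\in\mathcal I}$ with $w_i\in U(D)$ and $\sum_{i}\|w_i\|_{U(D)}<\infty$. For $X\subset\mathbb{C}^d$ compact, a family of maps $T_i:X\to X$ (resp. $w_i:X\to\mathbb{C}$) is a $C^\omega$ map system (resp. $C^\omega$ weight system) on $X$ if there is $D\in\mathcal D_d$ with $X\subset\subset D$ such that the $T_i$ (resp. $w_i$) extend to $D$ and the extensions form a holomorphic map system (resp. holomorphic weight system) on $D$; any such $D$ is called admissible for it. A $C^\omega$ map-weight system is a pair consisting of a $C^\omega$ map system and a $C^\omega$ weight system on $X$ indexed by the same $\mathcal I$; a domain is admissible for it if it is admissible for both. The extensions are denoted by the same symbols. The transfer operator $\mathcal L_{U(D)}$ is a compact operator on $U(D)$. For a compact operator $L$, its eigenvalue sequence $\{\lambda_n(L)\}_{n=1}^\infty$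 is the sequence of all (non-zero) eigenvalues counted with algebraic multiplicity and ordered by decreasing modulus (eigenvalues of equal modulus in any order), continued by zeros if there are only finitely many.
   Formalization: The strict inequality is stated for W ≠ 0 and replaced by ≤ when W = 0: if all weights w_i vanish on D, the operator is zero and both sides equal 0, so the printed "<" fails. *)

theory Defs
  imports "HOL-Analysis.Analysis" "HOL-Library.Function_Algebras"
begin

definition bounded_domain :: "(complex ^ 'n) set \<Rightarrow> bool" where
  "bounded_domain D \<longleftrightarrow> D \<noteq> {} \<and> open D \<and> connected D \<and> bounded D"

definition compactly_inside :: "(complex ^ 'n) set \<Rightarrow> (complex ^ 'n) set \<Rightarrow> bool" where
  "compactly_inside A B \<longleftrightarrow> closure A \<subseteq> B"

text \<open>
  The library has no class of complex normed spaces, so the complex scalar multiplication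
  \<open>sc\<close> of the target space is a parameter: \<open>(*)\<close> for the target \<open>complex\<close>,
  \<open>(*s)\<close> for \<open>complex ^ 'n\<close>.
\<close>

definition holomorphic_multi ::
    "(complex \<Rightarrow> 'b \<Rightarrow> 'b) \<Rightarrow> (complex ^ 'n \<Rightarrow> 'b::real_normed_vector) \<Rightarrow> (complex ^ 'n) set \<Rightarrow> bool" where
  "holomorphic_multi sc f D \<longleftrightarrow>
     (\<forall>z\<in>D. \<exists>f'. (f has_derivative f') (at z) \<and> Vector_Spaces.linear (*s) sc f')"

text \<open>
  The conditions for a function to belong to \<open>U(D,B)\<close>. Functions are total here, and their
  values off \<open>closure D\<close> are irrelevant to this predicate.
\<close>

definition cont_holomorphic ::
    "(complex \<Rightarrow> 'b \<Rightarrow> 'b) \<Rightarrow> (complex ^ 'n) set \<Rightarrow> (complex ^ 'n \<Rightarrow> 'b::real_normed_vector) \<Rightarrow> bool" where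
  "cont_holomorphic sc D f \<longleftrightarrow> continuous_on (closure D) f \<and> holomorphic_multi sc f D"

text \<open>
  The space \<open>U(D)\<close> of scalar functions. Setting the functions to zero off \<open>closure D\<close> selects
  one representative of each function on \<open>closure D\<close>, so that dimensions of subspaces are correct.
\<close>

definition U_space :: "(complex ^ 'n) set \<Rightarrow> (complex ^ 'n \<Rightarrow> complex) set" where
  "U_space D = {f. cont_holomorphic (*) D f \<and> (\<forall>z. z \<notin> closure D \<longrightarrow> f z = 0)}"

definition U_norm :: "(complex ^ 'n) set \<Rightarrow> (complex ^ 'n \<Rightarrow> complex) \<Rightarrow> real" where
  "U_norm D f = (SUP z\<in>closure D. norm (f z))"

definition holomorphic_map_system ::
    "(complex ^ 'n) set \<Rightarrow> 'i set \<Rightarrow> ('i \<Rightarrow> complex ^ 'n \<Rightarrow> complex ^ 'n) \<Rightarrow> bool" where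
  "holomorphic_map_system D I T \<longleftrightarrow>
     bounded_domain D \<and> countable I \<and> I \<noteq> {} \<and>
     (\<forall>i\<in>I. cont_holomorphic (*s) D (T i)) \<and> compactly_inside (\<Union>i\<in>I. T i ` D) D"

definition holomorphic_weight_system ::
    "(complex ^ 'n) set \<Rightarrow> 'i set \<Rightarrow> ('i \<Rightarrow> complex ^ 'n \<Rightarrow> complex) \<Rightarrow> bool" where
  "holomorphic_weight_system D I w \<longleftrightarrow>
     bounded_domain D \<and> countable I \<and> I \<noteq> {} \<and>
     (\<forall>i\<in>I. cont_holomorphic (*) D (w i)) \<and> (\<lambda>i. U_norm D (w i)) summable_on I"

text \<open>
  In the next definitions \<open>T\<close> and \<open>w\<close> are the systems on \<open>X\<close> (only their values on \<open>X\<close>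
  matter), while \<open>Te\<close> and \<open>we\<close> are the extensions witnessing that \<open>D\<close> is admissible.
\<close>

definition map_system_extension ::
    "(complex ^ 'n) set \<Rightarrow> (complex ^ 'n) set \<Rightarrow> 'i set \<Rightarrow>
     ('i \<Rightarrow> complex ^ 'n \<Rightarrow> complex ^ 'n) \<Rightarrow> ('i \<Rightarrow> complex ^ 'n \<Rightarrow> complex ^ 'n) \<Rightarrow> bool" where
  "map_system_extension X D I T Te \<longleftrightarrow>
     compactly_inside X D \<and> (\<forall>i\<in>I. \<forall>x\<in>X. Te i x = T i x) \<and> holomorphic_map_system D I Te"

definition weight_system_extension ::
    "(complex ^ 'n) set \<Rightarrow> (complex ^ 'n) set \<Rightarrow> 'i set \<Rightarrow>
     ('i \<Rightarrow> complex ^ 'n \<Rightarrow> complex) \<Rightarrow> ('i \<Rightarrow> complex ^ 'n \<Rightarrow> complex) \<Rightarrow> bool" where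
  "weight_system_extension X D I w we \<longleftrightarrow>
     compactly_inside X D \<and> (\<forall>i\<in>I. \<forall>x\<in>X. we i x = w i x) \<and> holomorphic_weight_system D I we"

definition Comega_map_system ::
    "(complex ^ 'n) set \<Rightarrow> 'i set \<Rightarrow> ('i \<Rightarrow> complex ^ 'n \<Rightarrow> complex ^ 'n) \<Rightarrow> bool" where
  "Comega_map_system X I T \<longleftrightarrow>
     (\<forall>i\<in>I. T i ` X \<subseteq> X) \<and> (\<exists>D Te. map_system_extension X D I T Te)"

definition Comega_weight_system ::
    "(complex ^ 'n) set \<Rightarrow> 'i set \<Rightarrow> ('i \<Rightarrow> complex ^ 'n \<Rightarrow> complex) \<Rightarrow> bool" where
  "Comega_weight_system X I w \<longleftrightarrow> (\<exists>D we. weight_system_extension X D I w we)"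

definition Comega_map_weight_system ::
    "(complex ^ 'n) set \<Rightarrow> 'i set \<Rightarrow> ('i \<Rightarrow> complex ^ 'n \<Rightarrow> complex ^ 'n) \<Rightarrow>
     ('i \<Rightarrow> complex ^ 'n \<Rightarrow> complex) \<Rightarrow> bool" where
  "Comega_map_weight_system X I T w \<longleftrightarrow> Comega_map_system X I T \<and> Comega_weight_system X I w"

definition transfer_operator ::
    "(complex ^ 'n) set \<Rightarrow> 'i set \<Rightarrow> ('i \<Rightarrow> complex ^ 'n \<Rightarrow> complex ^ 'n) \<Rightarrow>
     ('i \<Rightarrow> complex ^ 'n \<Rightarrow> complex) \<Rightarrow> (complex ^ 'n \<Rightarrow> complex) \<Rightarrow> (complex ^ 'n \<Rightarrow> complex)" where
  "transfer_operator D I T w f =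
     (\<lambda>z. if z \<in> closure D then \<Sum>\<^sub>\<infinity>i\<in>I. w i z * f (T i z) else 0)"

definition fun_scale :: "complex \<Rightarrow> ('a \<Rightarrow> complex) \<Rightarrow> ('a \<Rightarrow> complex)" where
  "fun_scale c f = (\<lambda>z. c * f z)"

lemma vector_space_fun_scale: "vector_space fun_scale"
  by unfold_locales (auto simp: fun_scale_def fun_eq_iff algebra_simps)

definition generalized_eigenspace ::
    "('a \<Rightarrow> complex) set \<Rightarrow> (('a \<Rightarrow> complex) \<Rightarrow> ('a \<Rightarrow> complex)) \<Rightarrow> complex \<Rightarrow> ('a \<Rightarrow> complex) set" where
  "generalized_eigenspace V L \<mu> = {f \<in> V. \<exists>k. ((\<lambda>g. L g - fun_scale \<mu> g) ^^ k) f = 0}"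

definition algebraic_multiplicity ::
    "('a \<Rightarrow> complex) set \<Rightarrow> (('a \<Rightarrow> complex) \<Rightarrow> ('a \<Rightarrow> complex)) \<Rightarrow> complex \<Rightarrow> nat" where
  "algebraic_multiplicity V L \<mu> = vector_space.dim fun_scale (generalized_eigenspace V L \<mu>)"

text \<open>
  The sequence is indexed from 1; \<open>ev 0\<close> is ignored. It is a predicate because eigenvalues of equal
  modulus may come in any order. A non-zero number that is not an eigenvalue has multiplicity 0 and
  hence does not occur, and since the moduli decrease, a zero can occur only after all non-zero
  eigenvalues have been listed. The definition is meant for compact \<open>L\<close> on \<open>V\<close>, where the
  generalized eigenspaces of non-zero \<open>\<mu>\<close> are finite-dimensional.
\<close>

definition eigenvalue_sequence ::
    "('a \<Rightarrow> complex) set \<Rightarrow> (('a \<Rightarrow> complex) \<Rightarrow> ('a \<Rightarrow> complex)) \<Rightarrow> (nat \<Rightarrow> complex) \<Rightarrow> bool" where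
  "eigenvalue_sequence V L ev \<longleftrightarrow>
     (\<forall>m n. 1 \<le> m \<and> m \<le> n \<longrightarrow> norm (ev n) \<le> norm (ev m)) \<and>
     (\<forall>\<mu>. \<mu> \<noteq> 0 \<longrightarrow> finite {n. 1 \<le> n \<and> ev n = \<mu>} \<and>
            card {n. 1 \<le> n \<and> ev n = \<mu>} = algebraic_multiplicity V L \<mu>)"

end

theory Submission
  imports Defs "HOL-Complex_Analysis.Complex_Analysis"
    "Jordan_Normal_Form.Schur_Decomposition" "Jordan_Normal_Form.Gauss_Jordan_Elimination"
begin

hide_const (open) Determinants.det

text \<open>
  The first \<open>n\<close> eigenvalues are the diagonal of a triangular matrix of the transfer operator on an invariant
  subspace with basis \<open>f\<^sub>1, \<dots>, f\<^sub>n\<close>, so it suffices to bound the determinant of the operator there and to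
  take \<open>n\<close>-th roots. Passing to the Lagrange basis \<open>g\<^sub>k\<close> at nearly Fekete points \<open>z\<^sub>j\<close>, this determinant is that
  of the matrix with entries \<open>(L g\<^sub>k)(z\<^sub>j)\<close>, the value at \<open>t = r\<close> of
  \<open>det (\<Sum>\<^sub>i w\<^sub>i(z\<^sub>j) g\<^sub>k(c + t (T\<^sub>i z\<^sub>j - c) / r))\<close>.
  The latter is holomorphic on the unit disc, is bounded there by \<open>(W \<surd>n)\<^sup>n\<close> by Hadamard's inequality (up to a
  factor arbitrarily close to 1), and vanishes at 0 to the order given by the total degree of the first \<open>n\<close>
  monomials in \<open>d\<close> variables, because only few homogeneous polynomials of each degree are linearly
  independent. The Schwarz lemma gives the bound, and counting monomials gives the exponent.
\<close>

section \<open>Holomorphic functions of several variables\<close>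

text \<open>The value \<open>t = r\<close> comes from the contraction: each image of a point lies
  within \<open>r * R\<close> of the centre \<open>c\<close>, so dividing its offset by
  \<open>r\<close> leaves a vector of norm at most \<open>R\<close>, and every \<open>t\<close> in
  the unit disc keeps the argument of \<open>g\<close> inside the ball. The Lagrange basis is what
  keeps the constant clean: it leaves the determinant unchanged, but an arbitrary basis would bring
  its own bounds into the estimate, whereas here every basis function is bounded by
  \<open>K\<close>, for any \<open>K > 1\<close>. Since each column of the matrix involves a single
  point, the weights enter through the supremum of the sum of their moduli and not through a sum of
  suprema. The two estimates on the disc have separate tasks. Hadamard's inequality alone fixes the
  constant; the row reduction that exhibits the zero at 0 may spoil constants freely, because the
  Schwarz lemma discards them. If \<open>s\<close> is the degree of monomial number
  \<open>k\<close>, counted from 0, then \<open>k + 1\<close> is at most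
  \<open>(s + d)^d / d!\<close>. Taking d-th roots loses \<open>d\<close>, which is the origin of
  the factor \<open>1 / r^d\<close>; averaging \<open>(k + 1)^(1/d)\<close> over \<open>k\<close>
  gives \<open>d / (d + 1)\<close>. For \<open>d = 1\<close> the count \<open>s \<ge> k\<close> has
  no such loss.\<close>

lemma linear_complex_vec_iff:
  fixes g :: "complex ^ 'n \<Rightarrow> complex"
  shows "Vector_Spaces.linear (*s) (*) g \<longleftrightarrow>
    (\<forall>x y. g (x + y) = g x + g y) \<and> (\<forall>a x. g (a *s x) = a * g x)"
proof -
  have "vector_space ((*) :: complex \<Rightarrow> complex \<Rightarrow> complex)"
    by unfold_locales (auto simp: algebra_simps)
  then show ?thesis
    by (auto simp: Vector_Spaces.linear_iff_module_hom Modules.module_hom_iff vec.module_axioms vector_space_def Modules.module_def)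
qed

lemma norm_vector_scalar_mult: "norm (t *s v) = norm t * norm v"
  for t :: complex and v :: "complex ^ 'n"
  by (simp add: norm_vec_def norm_mult L2_set_right_distrib)

lemma bounded_linear_vector_scalar_mult_left: "bounded_linear (\<lambda>t. t *s v)"
  for v :: "complex ^ 'n"
  by (rule bounded_linear_intro[where K = "norm v"])
     (auto simp: Finite_Cartesian_Product.vec_eq_iff algebra_simps norm_vector_scalar_mult)

lemma slice_has_field_derivative:
  fixes f :: "complex ^ 'n \<Rightarrow> complex"
  assumes "(f has_derivative f') (at (z + t *s v))" "Vector_Spaces.linear (*s) (*) f'"
  shows "((\<lambda>s. f (z + s *s v)) has_field_derivative f' v) (at t)"
proof -
  have "((\<lambda>s. z + s *s v) has_derivative (\<lambda>s. s *s v)) (at t)"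
    using has_derivative_add[OF has_derivative_const
      bounded_linear.has_derivative[OF bounded_linear_vector_scalar_mult_left has_derivative_ident]] by simp
  from has_derivative_compose[OF this assms(1)]
  moreover have "(\<lambda>s. f' (s *s v)) = (*) (f' v)"
    using assms(2) by (auto simp: linear_complex_vec_iff mult.commute)
  ultimately show ?thesis by (simp add: has_field_derivative_def)
qed

text \<open>Complex lines are the bridge to one-variable theory: Cauchy estimates, power series and
  the Schwarz lemma are applied to such restrictions only.\<close>

lemma holomorphic_on_slice:
  fixes f :: "complex ^ 'n \<Rightarrow> complex"
  assumes "holomorphic_multi (*) f S" "\<And>t. t \<in> A \<Longrightarrow> z + t *s v \<in> S"
  shows "(\<lambda>t. f (z + t *s v)) holomorphic_on A"
  unfolding holomorphic_on_def
proof
  fix t assume "t \<in> A"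
  then obtain f' where "(f has_derivative f') (at (z + t *s v))" "Vector_Spaces.linear (*s) (*) f'"
    using assms unfolding holomorphic_multi_def by blast
  from slice_has_field_derivative[OF this]
  show "(\<lambda>t. f (z + t *s v)) field_differentiable at t within A"
    using field_differentiable_at_within field_differentiable_def by blast
qed

lemma holomorphic_multi_continuous_on:
  fixes f :: "complex ^ 'n \<Rightarrow> complex"
  assumes "holomorphic_multi (*) f S" shows "continuous_on S f"
  using assms unfolding holomorphic_multi_def
  by (meson continuous_at_imp_continuous_on has_derivative_continuous)

lemma holomorphic_multi_subset:
  "holomorphic_multi sc f S \<Longrightarrow> S' \<subseteq> S \<Longrightarrow> holomorphic_multi sc f S'"
  unfolding holomorphic_multi_def by blast

lemma holomorphic_multi_const [simp]: "holomorphic_multi (*) (\<lambda>z::complex ^ 'n. a::complex) S"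
  unfolding holomorphic_multi_def
  by (auto intro!: exI[of _ "\<lambda>_. 0"] simp: linear_complex_vec_iff)

lemma holomorphic_multi_add:
  fixes f g :: "complex ^ 'n \<Rightarrow> complex"
  assumes "holomorphic_multi (*) f S" "holomorphic_multi (*) g S"
  shows "holomorphic_multi (*) (\<lambda>z. f z + g z) S"
  unfolding holomorphic_multi_def
proof
  fix z assume "z \<in> S"
  then obtain f' g' where "(f has_derivative f') (at z)" "Vector_Spaces.linear (*s) (*) f'"
    "(g has_derivative g') (at z)" "Vector_Spaces.linear (*s) (*) g'"
    using assms unfolding holomorphic_multi_def by blast
  then show "\<exists>h. ((\<lambda>z. f z + g z) has_derivative h) (at z) \<and> Vector_Spaces.linear (*s) (*) h"
    by (intro exI[of _ "\<lambda>x. f' x + g' x"])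
      (auto intro: has_derivative_add simp: linear_complex_vec_iff algebra_simps)
qed

lemma holomorphic_multi_mult:
  fixes f g :: "complex ^ 'n \<Rightarrow> complex"
  assumes "holomorphic_multi (*) f S" "holomorphic_multi (*) g S"
  shows "holomorphic_multi (*) (\<lambda>z. f z * g z) S"
  unfolding holomorphic_multi_def
proof
  fix z assume "z \<in> S"
  then obtain f' g' where "(f has_derivative f') (at z)" "Vector_Spaces.linear (*s) (*) f'"
    "(g has_derivative g') (at z)" "Vector_Spaces.linear (*s) (*) g'"
    using assms unfolding holomorphic_multi_def by blast
  then show "\<exists>h. ((\<lambda>z. f z * g z) has_derivative h) (at z) \<and> Vector_Spaces.linear (*s) (*) h"
    by (intro exI[of _ "\<lambda>x. f z * g' x + f' x * g z"])
      (auto intro: has_derivative_mult simp: linear_complex_vec_iff algebra_simps)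
qed

lemma holomorphic_multi_cmult:
  fixes f :: "complex ^ 'n \<Rightarrow> complex"
  shows "holomorphic_multi (*) f S \<Longrightarrow> holomorphic_multi (*) (\<lambda>z. a * f z) S"
  by (rule holomorphic_multi_mult) auto

lemma holomorphic_multi_diff:
  fixes f g :: "complex ^ 'n \<Rightarrow> complex"
  assumes "holomorphic_multi (*) f S" "holomorphic_multi (*) g S"
  shows "holomorphic_multi (*) (\<lambda>z. f z - g z) S"
  using holomorphic_multi_add[OF assms(1) holomorphic_multi_cmult[OF assms(2), of "-1"]] by simp

lemma holomorphic_multi_sum:
  fixes f :: "'a \<Rightarrow> complex ^ 'n \<Rightarrow> complex"
  shows "(\<And>a. a \<in> A \<Longrightarrow> holomorphic_multi (*) (f a) S) \<Longrightarrow> holomorphic_multi (*) (\<lambda>z. \<Sum>a\<in>A. f a z) S"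
  by (induction A rule: infinite_finite_induct) (auto intro: holomorphic_multi_add)

lemma holomorphic_multi_compose:
  fixes f :: "complex ^ 'n \<Rightarrow> complex" and g :: "complex ^ 'n \<Rightarrow> complex ^ 'n"
  assumes "holomorphic_multi (*) f S'" "holomorphic_multi (*s) g S" "g ` S \<subseteq> S'"
  shows "holomorphic_multi (*) (\<lambda>z. f (g z)) S"
  unfolding holomorphic_multi_def
proof
  fix z assume z: "z \<in> S"
  then obtain g' where g: "(g has_derivative g') (at z)" "Vector_Spaces.linear (*s) (*s) g'"
    using assms unfolding holomorphic_multi_def by blast
  obtain f' where f: "(f has_derivative f') (at (g z))" "Vector_Spaces.linear (*s) (*) f'"
    using assms z unfolding holomorphic_multi_def by blast
  have "Vector_Spaces.linear (*s) (*) (\<lambda>x. f' (g' x))"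
    using f(2) g(2) unfolding linear_complex_vec_iff
    by (simp add: Vector_Spaces.linear_iff_module_hom module_hom_iff)
  with has_derivative_compose[OF g(1) f(1)]
  show "\<exists>h. ((\<lambda>z. f (g z)) has_derivative h) (at z) \<and> Vector_Spaces.linear (*s) (*) h" by blast
qed

lemma holomorphic_multi_translate:
  fixes f :: "complex ^ 'n \<Rightarrow> complex"
  assumes "holomorphic_multi (*) f S'" "(\<lambda>z. z + a) ` S \<subseteq> S'"
  shows "holomorphic_multi (*) (\<lambda>z. f (z + a)) S"
proof (rule holomorphic_multi_compose[OF assms(1) _ assms(2)])
  show "holomorphic_multi (*s) (\<lambda>z. z + a) S"
    unfolding holomorphic_multi_def
  proof (intro ballI exI conjI)
    show "((\<lambda>z. z + a) has_derivative (\<lambda>x. x)) (at z)" for z by (auto intro!: derivative_eq_intros)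
    show "Vector_Spaces.linear (*s) (*s) (\<lambda>x::complex^'n. x)" using vec.linear_ident by auto
  qed
qed

text \<open>Cauchy's inequality for the slice through \<open>z\<close> in direction
  \<open>h\<close>, whose derivative at 0 is \<open>f' h\<close>.\<close>

lemma derivative_bound_on_ball:
  fixes f :: "complex ^ 'n \<Rightarrow> complex"
  assumes hol: "holomorphic_multi (*) f (ball z \<rho>)" and \<rho>: "0 < \<rho>"
    and B: "\<And>x. x \<in> ball z \<rho> \<Longrightarrow> norm (f x) \<le> B"
    and f': "(f has_derivative f') (at z)" "Vector_Spaces.linear (*s) (*) f'"
  shows "norm (f' h) \<le> 2 * B / \<rho> * norm h"
proof (cases "h = 0")
  case True
  have "f' 0 = 0" using f'(1) by (simp add: has_derivative_def linear_simps)
  with True show ?thesis by simp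
next
  case False
  \<comment> \<open>Half of the largest possible radius keeps the closed disc inside the open ball;
    this is the factor 2 in the bound.\<close>
  define s where "s = \<rho> / (2 * norm h)"
  have s: "s > 0" using False \<rho> by (simp add: s_def)
  have in_ball: "z + t *s h \<in> ball z \<rho>" if "t \<in> cball 0 s" for t
  proof -
    have "norm (t *s h) \<le> s * norm h"
      using that by (simp add: norm_vector_scalar_mult mult_right_mono)
    also have "\<dots> < \<rho>" using False \<rho> by (simp add: s_def)
    finally show ?thesis by (simp add: dist_norm)
  qed
  let ?\<phi> = "\<lambda>t. f (z + t *s h)"
  have "?\<phi> holomorphic_on cball 0 s"
    using holomorphic_on_slice[OF hol] in_ball by blast
  then have "norm ((deriv ^^ 1) ?\<phi> 0) \<le> fact 1 * B / s ^ 1"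
    by (intro Cauchy_inequality B in_ball s)
      (auto intro: holomorphic_on_imp_continuous_on holomorphic_on_subset)
  moreover have "deriv ?\<phi> 0 = f' h"
    by (rule DERIV_imp_deriv) (rule slice_has_field_derivative, use f' in auto)
  ultimately show ?thesis using False \<rho> by (simp add: s_def field_simps)
qed

text \<open>Weierstrass' theorem at one point: by the Cauchy estimate, uniform closeness of the
  approximants forces uniform closeness of their derivatives on the ball of half the radius, and
  complex linearity passes to the limit. The form with one approximant per \<open>e\<close> fits
  both difference quotients and finite partial sums of the operator.\<close>

lemma uniform_limit_holomorphic_derivative:
  fixes f :: "complex ^ 'n \<Rightarrow> complex"
  assumes \<rho>: "0 < \<rho>"
    and lim: "\<And>e. e > 0 \<Longrightarrow> \<exists>h. holomorphic_multi (*) h (ball z \<rho>) \<and> (\<forall>x\<in>ball z \<rho>. norm (f x - h x) \<le> e)"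
  shows "\<exists>f'. (f has_derivative f') (at z) \<and> Vector_Spaces.linear (*s) (*) f'"
proof -
  have "\<forall>k. \<exists>h. holomorphic_multi (*) h (ball z \<rho>) \<and> (\<forall>x\<in>ball z \<rho>. norm (f x - h x) \<le> inverse (Suc k))"
    using lim by simp
  then obtain h where h: "\<And>k. holomorphic_multi (*) (h k) (ball z \<rho>)"
    "\<And>k x. x \<in> ball z \<rho> \<Longrightarrow> norm (f x - h k x) \<le> inverse (Suc k)"
    by metis
  then have "\<forall>k. \<forall>x\<in>ball z \<rho>. \<exists>g. (h k has_derivative g) (at x) \<and> Vector_Spaces.linear (*s) (*) g"
    unfolding holomorphic_multi_def by blast
  then obtain D where D: "\<And>k x. x \<in> ball z \<rho> \<Longrightarrow> (h k has_derivative D k x) (at x)"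
    "\<And>k x. x \<in> ball z \<rho> \<Longrightarrow> Vector_Spaces.linear (*s) (*) (D k x)"
    by metis
  define S where "S = ball z (\<rho> / 2)"
  have S: "x \<in> ball z \<rho>" "ball x (\<rho> / 2) \<subseteq> ball z \<rho>" if "x \<in> S" for x
  proof -
    have x: "dist z x < \<rho> / 2" using that by (simp add: S_def)
    with \<rho> show "x \<in> ball z \<rho>" unfolding mem_ball by linarith
    show "ball x (\<rho> / 2) \<subseteq> ball z \<rho>"
    proof
      fix y assume "y \<in> ball x (\<rho> / 2)"
      with x dist_triangle[of z y x] show "y \<in> ball z \<rho>" unfolding mem_ball by linarith
    qed
  qed
  \<comment> \<open>The difference of two approximants is compared through \<open>f\<close>, and a
    ball of radius \<open>\<rho> / 2\<close> around any point of \<open>S\<close> is available for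
    the Cauchy estimate.\<close>
  have diff: "norm (D k x v - D l x v) \<le> 4 / \<rho> * norm v * (inverse (Suc k) + inverse (Suc l))"
    if x: "x \<in> S" for k l x v
  proof -
    have "norm ((\<lambda>v. D k x v - D l x v) v) \<le> 2 * (inverse (Suc k) + inverse (Suc l)) / (\<rho> / 2) * norm v"
    proof (rule derivative_bound_on_ball[where z = x and f = "\<lambda>y. h k y - h l y"])
      show "holomorphic_multi (*) (\<lambda>y. h k y - h l y) (ball x (\<rho> / 2))"
        using h(1) S(2)[OF x] by (intro holomorphic_multi_diff) (auto intro: holomorphic_multi_subset)
      show "norm (h k y - h l y) \<le> inverse (Suc k) + inverse (Suc l)" if "y \<in> ball x (\<rho> / 2)" for y
      proof -
        have "y \<in> ball z \<rho>" using S(2)[OF x] that by auto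
        then show ?thesis using h(2)[of y k] h(2)[of y l] norm_triangle_ineq4[of "f y - h l y" "f y - h k y"]
          by (simp add: algebra_simps)
      qed
      show "((\<lambda>y. h k y - h l y) has_derivative (\<lambda>v. D k x v - D l x v)) (at x)"
        using D(1) S(1)[OF x] by (intro has_derivative_diff)
      show "Vector_Spaces.linear (*s) (*) (\<lambda>v. D k x v - D l x v)"
        using D(2)[OF S(1)[OF x]] unfolding linear_complex_vec_iff by (auto simp: algebra_simps)
    qed (use \<rho> in auto)
    then show ?thesis by (simp add: field_simps)
  qed
  have inv: "(\<lambda>n. inverse (real (Suc n))) \<longlonglongrightarrow> 0" by (rule LIMSEQ_inverse_real_of_nat)
  have conv: "\<exists>l. (\<lambda>k. D k x v) \<longlonglongrightarrow> l" if x: "x \<in> S" for x v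
  proof -
    have "Cauchy (\<lambda>k. D k x v)"
    proof (rule metric_CauchyI)
      fix e :: real assume e: "e > 0"
      have "(\<lambda>n. 4 / \<rho> * norm v * (2 * inverse (real (Suc n)))) \<longlonglongrightarrow> 4 / \<rho> * norm v * (2 * 0)"
        by (intro tendsto_intros inv)
      then have "\<forall>\<^sub>F n in sequentially. 4 / \<rho> * norm v * (2 * inverse (real (Suc n))) < e"
        using e by (intro order_tendstoD(2)[where y = "4 / \<rho> * norm v * (2 * 0)"]) auto
      then obtain N where N: "4 / \<rho> * norm v * (2 * inverse (real (Suc N))) < e"
        unfolding eventually_sequentially by blast
      have "dist (D k x v) (D l x v) < e" if "k \<ge> N" "l \<ge> N" for k l
      proof -
        have "inverse (real (Suc k)) \<le> inverse (real (Suc N))" "inverse (real (Suc l)) \<le> inverse (real (Suc N))"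
          using that by (auto intro!: le_imp_inverse_le)
        then have "4 / \<rho> * norm v * (inverse (Suc k) + inverse (Suc l)) \<le> 4 / \<rho> * norm v * (2 * inverse (real (Suc N)))"
          using \<rho> by (intro mult_left_mono) (linarith, simp)
        with diff[OF x, of k v l] N show ?thesis by (simp add: dist_norm)
      qed
      then show "\<exists>M. \<forall>m\<ge>M. \<forall>n\<ge>M. dist (D m x v) (D n x v) < e" by blast
    qed
    then show ?thesis by (simp add: Cauchy_convergent_iff convergent_def)
  qed
  define g' where "g' x v = lim (\<lambda>k. D k x v)" for x v
  have g': "(\<lambda>k. D k x v) \<longlonglongrightarrow> g' x v" if "x \<in> S" for x v
    using conv[OF that] unfolding g'_def by (metis limI)
  have bound: "norm (D k x v - g' x v) \<le> 4 / \<rho> * inverse (Suc k) * norm v" if x: "x \<in> S" for k x v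
  proof (rule tendsto_le)
    show "(\<lambda>l. 4 / \<rho> * norm v * (inverse (Suc k) + inverse (Suc l))) \<longlonglongrightarrow> 4 / \<rho> * inverse (Suc k) * norm v"
      by (rule tendsto_eq_intros inv refl)+ simp
    show "(\<lambda>l. norm (D k x v - D l x v)) \<longlonglongrightarrow> norm (D k x v - g' x v)"
      by (intro tendsto_intros g' x)
  qed (use diff[OF x] in auto)
  have zS: "z \<in> S" using \<rho> by (simp add: S_def)
  have tof: "(\<lambda>k. h k x) \<longlonglongrightarrow> f x" if "x \<in> S" for x
  proof -
    have "(\<lambda>k. h k x - f x) \<longlonglongrightarrow> 0"
      by (rule Lim_null_comparison[OF _ inv]) (use h(2)[OF S(1)[OF that]] in \<open>simp add: norm_minus_commute\<close>)
    then show ?thesis by (simp add: LIM_zero_iff)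
  qed
  have "\<exists>g. \<forall>x\<in>S. (\<lambda>n. h n x) \<longlonglongrightarrow> g x \<and> (g has_derivative g' x) (at x within S)"
  proof (rule has_derivative_sequence[where f' = D])
    show "convex S" by (simp add: S_def)
    show "(h n has_derivative D n x) (at x within S)" if "x \<in> S" for n x
      using D(1)[OF S(1)[OF that]] has_derivative_at_withinI by blast
    fix e :: real assume e: "e > 0"
    have "(\<lambda>n. 4 / \<rho> * inverse (real (Suc n))) \<longlonglongrightarrow> 4 / \<rho> * 0"
      by (intro tendsto_intros inv)
    then have "\<forall>\<^sub>F n in sequentially. 4 / \<rho> * inverse (real (Suc n)) < e"
      using e by (intro order_tendstoD(2)[where y = "4 / \<rho> * 0"]) auto
    then show "\<forall>\<^sub>F n in sequentially. \<forall>x\<in>S. \<forall>v. norm (D n x v - g' x v) \<le> e * norm v"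
    proof eventually_elim
      case (elim n)
      show ?case
      proof (intro ballI allI)
        fix x v assume "x \<in> S"
        from bound[OF this, of n v] elim show "norm (D n x v - g' x v) \<le> e * norm v"
          by (smt (verit) mult_right_mono norm_ge_zero)
      qed
    qed
  qed (use zS tof in auto)
  then obtain g where g: "\<And>x. x \<in> S \<Longrightarrow> (\<lambda>n. h n x) \<longlonglongrightarrow> g x"
    "\<And>x. x \<in> S \<Longrightarrow> (g has_derivative g' x) (at x within S)" by blast
  have fg: "g x = f x" if "x \<in> S" for x using LIMSEQ_unique[OF g(1) tof] that by blast
  have "(g has_derivative g' z) (at z)"
    using g(2)[OF zS] zS at_within_open[OF zS] by (simp add: S_def)
  then have "(f has_derivative g' z) (at z)"
    by (rule has_derivative_transform_within_open[OF _ _ zS]) (use fg in \<open>auto simp: S_def\<close>)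
  moreover have "Vector_Spaces.linear (*s) (*) (g' z)"
    unfolding linear_complex_vec_iff
  proof (intro conjI allI)
    note lin = D(2)[OF S(1)[OF zS], unfolded linear_complex_vec_iff]
    show "g' z (x + y) = g' z x + g' z y" for x y
      using g'[OF zS, of "x + y"] tendsto_add[OF g'[OF zS, of x] g'[OF zS, of y]] lin
      by (auto intro: LIMSEQ_unique)
    show "g' z (a *s x) = a * g' z x" for a x
      using g'[OF zS, of "a *s x"] tendsto_mult[OF tendsto_const g'[OF zS, of x], of a] lin
      by (auto intro: LIMSEQ_unique)
  qed
  ultimately show ?thesis by blast
qed

section \<open>Partial derivatives of holomorphic functions\<close>

definition partial_deriv :: "'n::finite \<Rightarrow> (complex ^ 'n \<Rightarrow> complex) \<Rightarrow> complex ^ 'n \<Rightarrow> complex" where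
  "partial_deriv j f z = deriv (\<lambda>t. f (z + t *s axis j 1)) 0"

lemma holomorphic_quadratic_remainder:
  fixes \<phi> :: "complex \<Rightarrow> complex"
  assumes hol: "\<phi> holomorphic_on ball 0 \<rho>" and \<rho>: "\<rho> > 0"
    and B: "\<And>t. t \<in> ball 0 \<rho> \<Longrightarrow> norm (\<phi> t) \<le> B" and t: "norm t < \<rho> / 2"
  shows "norm (\<phi> t - \<phi> 0 - t * deriv \<phi> 0) \<le> 32 * B / \<rho>\<^sup>2 * (norm t)\<^sup>2"
proof -
  let ?S = "ball (0::complex) (\<rho> / 2)"
  have "norm ((deriv ^^ 0) \<phi> t - (\<Sum>i\<le>1. (deriv ^^ i) \<phi> 0 * (t - 0) ^ i / fact i))
      \<le> (32 * B / \<rho>\<^sup>2) * norm (t - 0) ^ Suc 1 / fact 1"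
  proof (rule complex_Taylor[where S = ?S])
    fix i x assume x: "x \<in> ?S"
    then have x': "x \<in> ball 0 \<rho>" using \<rho> by simp
    have "(deriv ^^ i) \<phi> holomorphic_on ball 0 \<rho>"
      by (rule holomorphic_higher_deriv[OF hol open_ball])
    from holomorphic_derivI[OF this open_ball x']
    show "((deriv ^^ i) \<phi> has_field_derivative (deriv ^^ Suc i) \<phi> x) (at x within ?S)"
      by (simp add: has_field_derivative_at_within)
  next
    fix x assume x: "x \<in> ?S"
    have sub: "cball x (\<rho> / 4) \<subseteq> ball 0 \<rho>"
    proof
      fix y assume "y \<in> cball x (\<rho> / 4)"
      with x \<rho> dist_triangle[of 0 y x] show "y \<in> ball 0 \<rho>" unfolding mem_ball mem_cball by linarith
    qed
    \<comment> \<open>A disc of radius \<open>\<rho> / 4\<close> around a point of the half disc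
      stays in the domain, and \<open>2 * B / (\<rho> / 4)^2\<close> is the constant
      \<open>32 * B / \<rho>^2\<close>.\<close>
    have "norm ((deriv ^^ 2) \<phi> x) \<le> fact 2 * B / (\<rho> / 4) ^ 2"
    proof (rule Cauchy_inequality)
      show "\<phi> holomorphic_on ball x (\<rho> / 4)"
        using hol sub ball_subset_cball by (blast intro: holomorphic_on_subset)
      show "continuous_on (cball x (\<rho> / 4)) \<phi>"
        using hol sub by (blast intro: holomorphic_on_imp_continuous_on holomorphic_on_subset)
      show "norm (\<phi> y) \<le> B" if "norm (x - y) = \<rho> / 4" for y
        using B sub that by (auto simp: subset_iff dist_norm)
    qed (use \<rho> in auto)
    then show "norm ((deriv ^^ Suc 1) \<phi> x) \<le> 32 * B / \<rho>\<^sup>2"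
      by (simp add: numeral_2_eq_2 field_simps)
  qed (use t \<rho> in auto)
  then show ?thesis by (simp add: power2_eq_square diff_diff_eq mult.commute)
qed

lemma derivative_axis:
  fixes f :: "complex ^ 'n \<Rightarrow> complex"
  assumes "(f has_derivative f') (at z)" "Vector_Spaces.linear (*s) (*) f'"
  shows "f' (axis j 1) = partial_deriv j f z"
  using slice_has_field_derivative[of f f' z 0 "axis j 1"] assms
  by (simp add: partial_deriv_def DERIV_imp_deriv)

lemma derivative_eq_sum_partial_deriv:
  fixes f :: "complex ^ 'n \<Rightarrow> complex"
  assumes "(f has_derivative f') (at z)" "Vector_Spaces.linear (*s) (*) f'"
  shows "f' v = (\<Sum>j\<in>UNIV. vec_nth v j * partial_deriv j f z)"
proof -
  note lin = assms(2)[unfolded linear_complex_vec_iff]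
  have f0: "f' 0 = 0" using lin by (metis add_cancel_right_left)
  have sum: "f' (sum g A) = (\<Sum>a\<in>A. f' (g a))" if "finite A" for g and A :: "'n set"
    using that by (induction A) (auto simp: lin f0)
  have "f' v = f' (\<Sum>j\<in>UNIV. vec_nth v j *s axis j 1)" by (simp add: basis_expansion)
  also have "\<dots> = (\<Sum>j\<in>UNIV. vec_nth v j * partial_deriv j f z)"
    by (simp add: sum lin derivative_axis[OF assms])
  finally show ?thesis .
qed

text \<open>For a fixed small \<open>t\<close> the difference quotient is holomorphic, and the
  quadratic remainder makes it uniformly close to the partial derivative near \<open>z\<close>;
  Weierstrass' theorem then applies without any integral formula in several variables.\<close>

lemma holomorphic_multi_partial_deriv:
  fixes f :: "complex ^ 'n \<Rightarrow> complex"
  assumes hol: "holomorphic_multi (*) f S" and S: "open S"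
  shows "holomorphic_multi (*) (partial_deriv j f) S"
  unfolding holomorphic_multi_def
proof
  fix z assume "z \<in> S"
  then obtain r where r: "r > 0" "cball z r \<subseteq> S" using S open_contains_cball by blast
  define \<rho> where "\<rho> = r / 2"
  have \<rho>: "\<rho> > 0" using r by (simp add: \<rho>_def)
  have "continuous_on (cball z r) f"
    using holomorphic_multi_continuous_on[OF hol] r(2) continuous_on_subset by blast
  then have "bounded (f ` cball z r)"
    by (intro compact_imp_bounded compact_continuous_image compact_cball)
  then obtain B where B: "\<And>x. x \<in> cball z r \<Longrightarrow> norm (f x) \<le> B"
    unfolding bounded_iff by blast
  have B0: "B \<ge> 0" using order_trans[OF norm_ge_zero B[of z]] r(1) by simp
  let ?e = "axis j 1 :: complex ^ 'n"
  have norm_e: "norm (t *s ?e) = norm t" for t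
    by (simp add: norm_vector_scalar_mult norm_axis_1)
  have in_cball: "x + t *s ?e \<in> cball z r" if "x \<in> ball z \<rho>" "norm t < \<rho>" for x t
  proof -
    have "dist z (x + t *s ?e) \<le> dist z x + dist x (x + t *s ?e)" by (rule dist_triangle)
    also have "\<dots> = dist z x + norm t" by (simp add: dist_norm norm_e)
    finally show ?thesis using that unfolding \<rho>_def mem_ball mem_cball by linarith
  qed
  show "\<exists>f'. (partial_deriv j f has_derivative f') (at z) \<and> Vector_Spaces.linear (*s) (*) f'"
  proof (rule uniform_limit_holomorphic_derivative[OF \<rho>])
    fix e :: real assume e: "e > 0"
    define C where "C = 32 * B / \<rho>\<^sup>2 + 1"
    have C: "C > 0" using B0 by (auto simp: C_def intro: add_nonneg_pos)
    \<comment> \<open>\<open>\<rho> / 3\<close> satisfies the strict half-radius condition of the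
      remainder estimate; \<open>e / C\<close> makes the error \<open>C * t\<close> of the quotient
      at most \<open>e\<close>.\<close>
    define t where "t = min (\<rho> / 3) (e / C)"
    have t: "t > 0" "t < \<rho> / 2" "C * t \<le> e"
      using \<rho> e C by (auto simp: t_def min_def field_simps)
    let ?q = "\<lambda>x. (1 / complex_of_real t) * (f (x + complex_of_real t *s ?e) - f x)"
    have "holomorphic_multi (*) ?q (ball z \<rho>)"
    proof (intro holomorphic_multi_cmult holomorphic_multi_diff holomorphic_multi_translate)
      show "(\<lambda>x. x + complex_of_real t *s ?e) ` ball z \<rho> \<subseteq> S"
        using in_cball r(2) t \<rho> by force
      show "holomorphic_multi (*) f (ball z \<rho>)"
        using r \<rho> by (intro holomorphic_multi_subset[OF hol]) (auto simp: \<rho>_def subset_iff)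
    qed (rule hol)
    moreover have "norm (partial_deriv j f x - ?q x) \<le> e" if x: "x \<in> ball z \<rho>" for x
    proof -
      let ?\<phi> = "\<lambda>t. f (x + t *s ?e)"
      have "?\<phi> holomorphic_on ball 0 \<rho>"
        by (rule holomorphic_on_slice[OF hol]) (auto intro!: subsetD[OF r(2)] in_cball[OF x])
      then have "norm (?\<phi> t - ?\<phi> 0 - t * deriv ?\<phi> 0) \<le> 32 * B / \<rho>\<^sup>2 * (norm (complex_of_real t))\<^sup>2"
        using \<rho> t B in_cball[OF x] by (intro holomorphic_quadratic_remainder) auto
      also have "\<dots> \<le> C * t\<^sup>2" using t(1) by (simp add: C_def distrib_right)
      finally have le: "norm (?\<phi> t - ?\<phi> 0 - t * deriv ?\<phi> 0) \<le> C * t\<^sup>2" .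
      have "partial_deriv j f x - ?q x = - (1 / complex_of_real t) * (?\<phi> t - ?\<phi> 0 - t * deriv ?\<phi> 0)"
        using t(1) by (simp add: partial_deriv_def field_simps)
      then have "norm (partial_deriv j f x - ?q x) = 1 / t * norm (?\<phi> t - ?\<phi> 0 - t * deriv ?\<phi> 0)"
        using t(1) by (simp add: norm_mult norm_divide)
      also have "\<dots> \<le> 1 / t * (C * t\<^sup>2)" using le t(1) by (intro mult_left_mono) auto
      also have "\<dots> = C * t" using t(1) by (simp add: power2_eq_square)
      finally show ?thesis using t(3) by simp
    qed
    ultimately show "\<exists>h. holomorphic_multi (*) h (ball z \<rho>) \<and> (\<forall>x\<in>ball z \<rho>. norm (partial_deriv j f x - h x) \<le> e)"
      by blast
  qed
qed

lemma slice_has_field_derivative_partial: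
  fixes f :: "complex ^ 'n \<Rightarrow> complex"
  assumes "holomorphic_multi (*) f S" "z + t *s v \<in> S"
  shows "((\<lambda>s. f (z + s *s v)) has_field_derivative
    (\<Sum>j\<in>UNIV. vec_nth v j * partial_deriv j f (z + t *s v))) (at t)"
proof -
  obtain f' where f': "(f has_derivative f') (at (z + t *s v))" "Vector_Spaces.linear (*s) (*) f'"
    using assms unfolding holomorphic_multi_def by blast
  from slice_has_field_derivative[OF this] derivative_eq_sum_partial_deriv[OF this] show ?thesis by simp
qed

text \<open>The list records the order of differentiation, its head being applied last, so no
  symmetry of mixed derivatives is presupposed.\<close>

definition partial_derivs :: "'n::finite list \<Rightarrow> (complex ^ 'n \<Rightarrow> complex) \<Rightarrow> complex ^ 'n \<Rightarrow> complex" where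
  "partial_derivs J f = foldr partial_deriv J f"

lemma holomorphic_multi_partial_derivs:
  assumes "holomorphic_multi (*) f S" "open S"
  shows "holomorphic_multi (*) (partial_derivs J f) S"
  using assms by (induction J) (auto simp: partial_derivs_def holomorphic_multi_partial_deriv)

section \<open>Vanishing order along slices\<close>

text \<open>Functions are total but controlled on \<open>S\<close> only, hence the identity is
  assumed there; as \<open>S\<close> is open, this suffices for derivatives at its points.\<close>

lemma partial_deriv_sum_cmult:
  fixes f :: "'a \<Rightarrow> complex ^ 'n \<Rightarrow> complex"
  assumes hol: "\<And>a. a \<in> A \<Longrightarrow> holomorphic_multi (*) (f a) S" and S: "open S" and z: "z \<in> S"
    and eq: "\<And>z. z \<in> S \<Longrightarrow> h z = (\<Sum>a\<in>A. u a * f a z)"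
  shows "partial_deriv j h z = (\<Sum>a\<in>A. u a * partial_deriv j (f a) z)"
proof -
  let ?e = "axis j 1 :: complex ^ 'n"
  have der: "((\<lambda>t. f a (z + t *s ?e)) has_field_derivative partial_deriv j (f a) z) (at 0)" if a: "a \<in> A" for a
  proof -
    obtain f' where f': "(f a has_derivative f') (at z)" "Vector_Spaces.linear (*s) (*) f'"
      using hol[OF a] z unfolding holomorphic_multi_def by blast
    with slice_has_field_derivative[of "f a" f' z 0 ?e] derivative_axis[OF f', of j] show ?thesis by simp
  qed
  have "((\<lambda>t. \<Sum>a\<in>A. u a * f a (z + t *s ?e)) has_field_derivative (\<Sum>a\<in>A. u a * partial_deriv j (f a) z)) (at 0)"
    by (intro DERIV_sum DERIV_cmult der)
  moreover have "continuous_on UNIV (\<lambda>t. z + t *s ?e)"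
    by (intro continuous_intros linear_continuous_on bounded_linear_vector_scalar_mult_left)
  then have "open ((\<lambda>t. z + t *s ?e) -` S)" using S by (simp add: open_vimage)
  ultimately have "((\<lambda>t. h (z + t *s ?e)) has_field_derivative (\<Sum>a\<in>A. u a * partial_deriv j (f a) z)) (at 0)"
    by (rule has_field_derivative_transform_within_open) (use z eq in auto)
  then show ?thesis unfolding partial_deriv_def by (rule DERIV_imp_deriv)
qed

lemma partial_derivs_sum_cmult:
  fixes f :: "'a \<Rightarrow> complex ^ 'n \<Rightarrow> complex"
  assumes hol: "\<And>a. a \<in> A \<Longrightarrow> holomorphic_multi (*) (f a) S" and S: "open S" and z: "z \<in> S"
    and eq: "\<And>z. z \<in> S \<Longrightarrow> h z = (\<Sum>a\<in>A. u a * f a z)"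
  shows "partial_derivs J h z = (\<Sum>a\<in>A. u a * partial_derivs J (f a) z)"
  using z
proof (induction J arbitrary: z)
  case Nil
  then show ?case using eq by (simp add: partial_derivs_def)
next
  case (Cons j J)
  have "partial_deriv j (partial_derivs J h) z = (\<Sum>a\<in>A. u a * partial_deriv j (partial_derivs J (f a)) z)"
    using Cons.prems Cons.IH holomorphic_multi_partial_derivs[OF hol S] S
    by (intro partial_deriv_sum_cmult[where S = S]) auto
  then show ?case by (simp add: partial_derivs_def)
qed

lemma sum_lists_length_Suc:
  fixes g :: "'a::finite list \<Rightarrow> 'b::comm_monoid_add"
  shows "(\<Sum>J | length J = Suc m. g J) = (\<Sum>J | length J = m. \<Sum>j\<in>UNIV. g (j # J))"
proof -
  have "(\<Sum>J | length J = m. \<Sum>j\<in>UNIV. g (j # J)) = (\<Sum>(J, j)\<in>{J. length J = m} \<times> UNIV. g (j # J))"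
    by (rule sum.cartesian_product)
  also have "\<dots> = (\<Sum>J | length J = Suc m. g J)"
    by (rule sum.reindex_bij_witness[where i = "\<lambda>J. (tl J, hd J)" and j = "\<lambda>(J, j). j # J"])
      (auto simp: length_Suc_conv)
  finally show ?thesis by simp
qed

text \<open>One differentiation along \<open>v\<close> is the operator that sums \<open>v j\<close>
  times the \<open>j\<close>-th partial derivative. Its \<open>m\<close>-th power expands over all
  words of length \<open>m\<close>, a multinomial formula before collecting equal monomials.\<close>

lemma higher_deriv_slice:
  fixes f :: "complex ^ 'n \<Rightarrow> complex"
  assumes hol: "holomorphic_multi (*) f S" and S: "open S" and A: "open A" "\<And>t. t \<in> A \<Longrightarrow> z + t *s v \<in> S"
    and "t \<in> A"
  shows "(deriv ^^ m) (\<lambda>t. f (z + t *s v)) t =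
    (\<Sum>J | length J = m. (\<Prod>j\<leftarrow>J. vec_nth v j) * partial_derivs J f (z + t *s v))"
  using \<open>t \<in> A\<close>
proof (induction m arbitrary: t)
  case 0
  then show ?case by (simp add: partial_derivs_def)
next
  case (Suc m)
  let ?R = "\<lambda>t. \<Sum>J | length J = m. (\<Prod>j\<leftarrow>J. vec_nth v j) * partial_derivs J f (z + t *s v)"
  let ?D = "\<Sum>J | length J = m. (\<Prod>j\<leftarrow>J. vec_nth v j) *
    (\<Sum>j\<in>UNIV. vec_nth v j * partial_deriv j (partial_derivs J f) (z + t *s v))"
  have "(?R has_field_derivative ?D) (at t)"
    using A(2)[OF Suc.prems]
    by (intro DERIV_sum DERIV_cmult slice_has_field_derivative_partial[where S = S]
        holomorphic_multi_partial_derivs hol S)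
  then have "((deriv ^^ m) (\<lambda>t. f (z + t *s v)) has_field_derivative ?D) (at t)"
    by (rule has_field_derivative_transform_within_open[OF _ A(1) Suc.prems]) (use Suc.IH in auto)
  then have "(deriv ^^ Suc m) (\<lambda>t. f (z + t *s v)) t = ?D" by (simp add: DERIV_imp_deriv)
  also have "\<dots> = (\<Sum>J | length J = Suc m. (\<Prod>j\<leftarrow>J. vec_nth v j) * partial_derivs J f (z + t *s v))"
    by (simp add: sum_lists_length_Suc sum_distrib_left partial_derivs_def mult_ac)
  finally show ?case .
qed

text \<open>
  Up to the factor \<open>size M\<close> factorial, this is the coefficient of the monomial \<open>M\<close> in the Taylor expansion of \<open>f\<close> at
  \<open>c\<close>. Summing over all orders of differentiation avoids a proof that partial derivatives commute.
\<close>

definition taylor_functional :: "complex ^ 'n \<Rightarrow> 'n multiset \<Rightarrow> (complex ^ 'n \<Rightarrow> complex) \<Rightarrow> complex" where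
  "taylor_functional c M f = (\<Sum>J | mset J = M. partial_derivs J f c)"

lemma taylor_functional_sum_cmult:
  fixes f :: "'a \<Rightarrow> complex ^ 'n \<Rightarrow> complex"
  assumes "\<And>a. a \<in> A \<Longrightarrow> holomorphic_multi (*) (f a) S" "open S" "c \<in> S"
    "\<And>z. z \<in> S \<Longrightarrow> h z = (\<Sum>a\<in>A. u a * f a z)"
  shows "taylor_functional c M h = (\<Sum>a\<in>A. u a * taylor_functional c M (f a))"
proof -
  have "partial_derivs J h c = (\<Sum>a\<in>A. u a * partial_derivs J (f a) c)" for J
    by (rule partial_derivs_sum_cmult[OF assms])
  then show ?thesis
    unfolding taylor_functional_def sum_distrib_left by (simp add: sum.swap[of _ _ A])
qed

lemma higher_deriv_slice_eq_0:
  fixes f :: "complex ^ 'n \<Rightarrow> complex"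
  assumes hol: "holomorphic_multi (*) f S" and S: "open S" and A: "open A" "\<And>t. t \<in> A \<Longrightarrow> c + t *s v \<in> S"
    and "0 \<in> A" and zero: "\<And>M. size M = m \<Longrightarrow> taylor_functional c M f = 0"
  shows "(deriv ^^ m) (\<lambda>t. f (c + t *s v)) 0 = 0"
proof -
  let ?L = "{J :: 'n list. length J = m}"
  have fin: "finite ?L" using finite_lists_length_eq[of "UNIV :: 'n set" m] by simp
  have "(deriv ^^ m) (\<lambda>t. f (c + t *s v)) 0 = (\<Sum>J\<in>?L. (\<Prod>j\<leftarrow>J. vec_nth v j) * partial_derivs J f c)"
    using higher_deriv_slice[OF hol S A \<open>0 \<in> A\<close>, of m] by simp
  \<comment> \<open>The product of the coordinates of \<open>v\<close> along a word depends on its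
    multiset alone, so collecting words by multiset leaves \<open>taylor_functional\<close> as
    coefficient.\<close>
  also have "\<dots> = (\<Sum>M\<in>mset ` ?L. \<Sum>J\<in>{J\<in>?L. mset J = M}. (\<Prod>j\<leftarrow>J. vec_nth v j) * partial_derivs J f c)"
    by (rule sum.image_gen[OF fin])
  also have "\<dots> = (\<Sum>M\<in>mset ` ?L. prod_mset (image_mset (vec_nth v) M) * taylor_functional c M f)"
  proof (intro sum.cong refl)
    fix M assume "M \<in> mset ` ?L"
    then have *: "{J\<in>?L. mset J = M} = {J. mset J = M}" by (auto dest: mset_eq_length)
    show "(\<Sum>J\<in>{J\<in>?L. mset J = M}. (\<Prod>j\<leftarrow>J. vec_nth v j) * partial_derivs J f c) =
        prod_mset (image_mset (vec_nth v) M) * taylor_functional c M f"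
      unfolding * taylor_functional_def sum_distrib_left
      by (intro sum.cong refl) (auto simp flip: mset_map prod_mset_prod_list)
  qed
  also have "\<dots> = 0" using zero by (intro sum.neutral) auto
  finally show ?thesis .
qed

text \<open>Excluding \<open>t = 0\<close> spares the removable singularity in the induction step.\<close>

lemma Schwarz_power:
  fixes F :: "complex \<Rightarrow> complex"
  assumes "F holomorphic_on ball 0 1"
    and "\<And>t. t \<in> ball 0 1 - {0} \<Longrightarrow> norm (F t) \<le> B"
    and "\<And>t. t \<in> ball 0 1 - {0} \<Longrightarrow> norm (F t) \<le> C * norm t ^ m"
    and "t \<in> ball 0 1 - {0}"
  shows "norm (F t) \<le> B * norm t ^ m"
  using assms
proof (induction m arbitrary: F t)
  case 0
  then show ?case by simp
next
  case (Suc m)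
  note hol = Suc.prems(1) and B = Suc.prems(2) and C = Suc.prems(3)
  have B0: "B \<ge> 0" using order_trans[OF norm_ge_zero B[OF Suc.prems(4)]] .
  have cont: "isCont F 0"
    by (rule continuous_on_interior[OF holomorphic_on_imp_continuous_on[OF hol]]) simp
  have ev: "\<forall>\<^sub>F t in at (0::complex). t \<in> ball 0 1 - {0}"
    by (rule eventually_at_in_open) auto
  have "(F \<longlongrightarrow> 0) (at 0)"
  proof (rule Lim_null_comparison)
    show "\<forall>\<^sub>F t in at 0. norm (F t) \<le> C * norm t ^ Suc m"
      using ev by eventually_elim (rule C)
    have "((\<lambda>t::complex. C * norm t ^ Suc m) \<longlongrightarrow> C * norm (0::complex) ^ Suc m) (at 0)"
      by (intro tendsto_intros)
    then show "((\<lambda>t::complex. C * norm t ^ Suc m) \<longlongrightarrow> 0) (at 0)" by simp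
  qed
  with cont have F0: "F 0 = 0" unfolding isCont_def using LIM_unique by blast
  \<comment> \<open>The quotient \<open>F t / t\<close>, completed at 0 and written in the shape of
    \<open>pole_theorem\<close>; \<open>F 0 = 0\<close> removes the extra term.\<close>
  define G where "G t = (if t = 0 then deriv F 0 else F t / t - F 0 / (t - 0))" for t
  have "(\<lambda>z. if z = 0 then deriv F 0 else F z / z - F 0 / (z - 0)) holomorphic_on ball 0 1"
    by (rule pole_theorem[OF hol]) auto
  then have holG: "G holomorphic_on ball 0 1" by (simp add: G_def [abs_def])
  have G: "G t = F t / t" if "t \<noteq> 0" for t using that F0 by (simp add: G_def)
  have le: "norm (F t) \<le> B * norm t" if t: "t \<in> ball 0 1" for t
  proof (rule field_le_epsilon)
    fix e :: real assume e: "e > 0"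
    \<comment> \<open>The Schwarz lemma asks for a strict bound by 1 after normalisation; enlarging
      \<open>B\<close> provides it and also covers \<open>B = 0\<close>.\<close>
    define b where "b = B + e"
    have b: "b > 0" using B0 e by (simp add: b_def)
    have "norm (F s / of_real b) < 1" if "norm s < 1" for s
    proof -
      have "norm (F s) < b"
        using B[of s] that b e F0 by (cases "s = 0") (auto simp: b_def)
      then show ?thesis using b by (simp add: norm_divide)
    qed
    then have "norm (F t / of_real b) \<le> norm t"
      using t b F0 by (intro Schwarz_Lemma(1) holomorphic_intros hol) auto
    then have "norm (F t) \<le> b * norm t" using b by (simp add: norm_divide field_simps)
    also have "\<dots> \<le> B * norm t + e"
      using t e mult_left_le[of "norm t" e] by (simp add: b_def algebra_simps)
    finally show "norm (F t) \<le> B * norm t + e" .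
  qed
  have "norm (G t) \<le> B * norm t ^ m"
  proof (rule Suc.IH[OF holG])
    fix t :: complex assume t: "t \<in> ball 0 1 - {0}"
    show "norm (G t) \<le> B" using le[of t] t by (simp add: G norm_divide field_simps)
    show "norm (G t) \<le> C * norm t ^ m" using C[OF t] t by (simp add: G norm_divide field_simps)
  qed (rule Suc.prems(4))
  then show ?case using Suc.prems(4) by (simp add: G norm_divide field_simps)
qed

text \<open>Near 0 the power series starts at order \<open>m\<close>; for
  \<open>norm t > 1/2\<close> the factor \<open>(2 * norm t) ^ m\<close> is at least 1. The constant
  \<open>C\<close> is of no quality, but it is all that \<open>Schwarz_power\<close> requires to
  restore the constant \<open>B\<close>.\<close>

lemma norm_le_of_vanishing_derivs:
  fixes F :: "complex \<Rightarrow> complex"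
  assumes hol: "F holomorphic_on ball 0 1"
    and B: "\<And>t. t \<in> ball 0 1 \<Longrightarrow> norm (F t) \<le> B"
    and zero: "\<And>i. i < m \<Longrightarrow> (deriv ^^ i) F 0 = 0"
  shows "\<exists>C. \<forall>t\<in>ball 0 1. norm (F t) \<le> C * norm t ^ m"
proof -
  define a where "a i = (deriv ^^ i) F 0 / fact i" for i
  have sums: "(\<lambda>i. a i * t ^ i) sums F t" if "t \<in> ball 0 1" for t
    using holomorphic_power_series[OF hol that] by (simp add: a_def)
  \<comment> \<open>Convergence at the larger radius 3/4 yields absolute convergence at 1/2.\<close>
  have "summable (\<lambda>i. a i * (3/4) ^ i)"
    using sums[of "3/4"] by (auto simp: sums_iff norm_divide)
  from powser_insidea[OF this, of "1/2"] have s: "summable (\<lambda>i. norm (a i * (1/2) ^ i))"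
    by (simp add: norm_divide)
  define K where "K = (\<Sum>i. norm (a (i + m) * (1/2) ^ i))"
  have s': "summable (\<lambda>i. norm (a (i + m) * (1/2) ^ i))"
  proof -
    have "summable (\<lambda>i. 2 ^ m * norm (a (i + m) * (1/2) ^ (i + m)))"
      using s by (intro summable_mult) (subst summable_iff_shift)
    then show ?thesis by (simp add: norm_mult norm_power norm_divide power_add field_simps)
  qed
  have small: "norm (F t) \<le> K * norm t ^ m" if t: "norm t \<le> 1/2" for t
  proof -
    have le: "norm (a (i + m) * t ^ i) \<le> norm (a (i + m) * (1/2) ^ i)" for i
      using power_mono[OF t, of i] by (simp add: norm_mult norm_power norm_divide mult_left_mono)
    have sm: "summable (\<lambda>i. a (i + m) * t ^ i)"
      by (rule summable_comparison_test'[OF s']) (use le in auto)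
    have "(\<lambda>i. a (i + m) * t ^ (i + m)) sums (F t - (\<Sum>i<m. a i * t ^ i))"
      using sums[of t] t by (intro sums_split_initial_segment) auto
    then have "F t = (\<Sum>i. a (i + m) * t ^ (i + m))"
      using zero by (simp add: sums_iff a_def)
    also have "\<dots> = (\<Sum>i. a (i + m) * t ^ i) * t ^ m"
      using suminf_mult2[OF sm, of "t ^ m"] by (simp add: power_add mult_ac)
    finally have "norm (F t) = norm (\<Sum>i. a (i + m) * t ^ i) * norm t ^ m"
      by (simp add: norm_mult norm_power)
    moreover have "norm (\<Sum>i. a (i + m) * t ^ i) \<le> K"
      unfolding K_def by (rule order_trans[OF summable_norm suminf_le[OF le _ s']]) (rule summable_comparison_test'[OF s'], use le in auto)+
    ultimately show ?thesis by (simp add: mult_right_mono)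
  qed
  have B0: "B \<ge> 0" using order_trans[OF norm_ge_zero B[of 0]] by simp
  have K0: "K \<ge> 0" unfolding K_def by (rule suminf_nonneg[OF s']) simp
  have "norm (F t) \<le> (K + B * 2 ^ m) * norm t ^ m" if t: "t \<in> ball 0 1" for t
  proof (cases "norm t \<le> 1/2")
    case True
    from small[OF this] B0 show ?thesis by (simp add: distrib_right add_increasing2)
  next
    case False
    then have "1 \<le> (2 * norm t) ^ m" by (intro one_le_power) auto
    then have "B * 1 \<le> B * (2 * norm t) ^ m" using B0 by (intro mult_left_mono)
    then have "B \<le> (B * 2 ^ m) * norm t ^ m" by (simp add: power_mult_distrib mult.assoc)
    with B[OF t] K0 show ?thesis by (simp add: distrib_right add_increasing)
  qed
  then show ?thesis by blast
qed

text \<open>Vanishing of all Taylor coefficients of degree below \<open>m\<close> at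
  \<open>c\<close> gives every slice through \<open>c\<close> a zero of order \<open>m\<close> at 0,
  whatever its direction; the Schwarz lemma does the rest.\<close>

lemma slice_bound_of_vanishing_taylor:
  fixes f :: "complex ^ 'n \<Rightarrow> complex"
  assumes hol: "holomorphic_multi (*) f (ball c R)"
    and B: "\<And>z. z \<in> ball c R \<Longrightarrow> norm (f z) \<le> B"
    and zero: "\<And>M. size M < m \<Longrightarrow> taylor_functional c M f = 0"
    and v: "norm v \<le> R" and R: "R > 0" and t: "t \<in> ball 0 1"
  shows "norm (f (c + t *s v)) \<le> B * norm t ^ m"
proof -
  have in_ball: "c + s *s v \<in> ball c R" if "s \<in> ball 0 1" for s
  proof (cases "v = 0")
    case True
    have "s *s (0 :: complex ^ 'n) = 0" by (simp add: Finite_Cartesian_Product.vec_eq_iff)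
    then show ?thesis using True R by simp
  next
    case False
    then have "norm s * norm v < 1 * norm v" using that by (intro mult_strict_right_mono) auto
    then show ?thesis using v by (simp add: dist_norm norm_vector_scalar_mult)
  qed
  let ?F = "\<lambda>s. f (c + s *s v)"
  have holF: "?F holomorphic_on ball 0 1" by (rule holomorphic_on_slice[OF hol in_ball])
  have FB: "norm (?F s) \<le> B" if "s \<in> ball 0 1" for s using B[OF in_ball[OF that]] .
  have "(deriv ^^ i) ?F 0 = 0" if "i < m" for i
    by (rule higher_deriv_slice_eq_0[OF hol open_ball open_ball[of 0 1] in_ball]) (use zero that in auto)
  from norm_le_of_vanishing_derivs[OF holF FB this]
  obtain C where C: "\<And>s. s \<in> ball 0 1 \<Longrightarrow> norm (?F s) \<le> C * norm s ^ m" by blast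
  show ?thesis
  proof (cases "t = 0")
    case True
    show ?thesis
    proof (cases "m = 0")
      case True
      then show ?thesis using FB[OF t] by simp
    next
      case False
      then show ?thesis using True C[OF t] by (simp add: power_0_left)
    qed
  next
    case False
    show ?thesis
      by (rule Schwarz_power[OF holF, where C = C]) (use FB C t \<open>t \<noteq> 0\<close> in \<open>simp_all del: mem_ball\<close>)
  qed
qed

section \<open>Determinants of complex matrices\<close>

lemma mat_mult_index:
  assumes "A \<in> carrier_mat n m" "B \<in> carrier_mat m l" "i < n" "j < l"
  shows "(A * B) $$ (i, j) = (\<Sum>k<m. A $$ (i, k) * B $$ (k, j))"
  using assms by (auto simp: scalar_prod_def intro!: sum.cong)

lemma trace_mult_commute:
  fixes A B :: "'a :: comm_ring_1 mat"
  assumes "A \<in> carrier_mat n n" "B \<in> carrier_mat n n"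
  shows "(\<Sum>i<n. (A * B) $$ (i, i)) = (\<Sum>i<n. (B * A) $$ (i, i))"
proof -
  have "(\<Sum>i<n. (A * B) $$ (i, i)) = (\<Sum>i<n. \<Sum>k<n. A $$ (i, k) * B $$ (k, i))"
    by (intro sum.cong refl mat_mult_index[OF assms]) auto
  also have "\<dots> = (\<Sum>k<n. \<Sum>i<n. B $$ (k, i) * A $$ (i, k))"
    by (subst sum.swap) (simp add: mult.commute)
  also have "\<dots> = (\<Sum>i<n. (B * A) $$ (i, i))"
    by (intro sum.cong refl mat_mult_index[OF assms(2,1), symmetric]) auto
  finally show ?thesis .
qed

section \<open>Hadamard's inequality\<close>

lemma prod_le_power_mean:
  fixes x :: "nat \<Rightarrow> real"
  assumes "\<And>i. i < n \<Longrightarrow> 0 \<le> x i" "n > 0"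
  shows "(\<Prod>i<n. x i) \<le> ((\<Sum>i<n. x i) / n) ^ n"
proof -
  let ?P = "\<Prod>i<n. x i"
  have P: "?P \<ge> 0" using assms by (auto intro: prod_nonneg)
  have "?P powr (1 / n) \<le> (\<Sum>i<n. x i) / n"
    using arith_geom_mean[of "{..<n}" x] assms by (simp add: sum_divide_distrib lessThan_empty_iff)
  then have "(?P powr (1 / n)) ^ n \<le> ((\<Sum>i<n. x i) / n) ^ n"
    by (intro power_mono) auto
  moreover have "(?P powr (1 / n)) ^ n = ?P"
  proof (cases "?P = 0")
    case False
    then have "?P powr (1 / n) > 0" by simp
    then show ?thesis using P assms(2) by (subst powr_realpow[symmetric]) (simp_all add: powr_powr)
  next
    case True
    show ?thesis unfolding True using assms(2) by simp
  qed
  ultimately show ?thesis by simp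
qed

text \<open>For an eigenvector \<open>v\<close> of the Gram matrix, pairing with \<open>v\<close>
  gives \<open>a\<close> times the squared norm of \<open>v\<close> on one side and the squared norm
  of the adjoint of \<open>A\<close> applied to \<open>v\<close> on the other.\<close>

lemma gram_eigenvalue_nonneg:
  fixes A :: "complex mat"
  assumes A: "A \<in> carrier_mat n n"
    and ev: "eigenvalue (A * mat n n (\<lambda>(i, j). cnj (A $$ (j, i)))) a"
  shows "\<exists>x\<ge>0. a = complex_of_real x"
proof -
  let ?C = "mat n n (\<lambda>(i, j). cnj (A $$ (j, i)))"
  have C: "?C \<in> carrier_mat n n" by simp
  obtain v where v: "v \<in> carrier_vec n" "v \<noteq> 0\<^sub>v n" "(A * ?C) *\<^sub>v v = a \<cdot>\<^sub>v v"
    using ev A unfolding eigenvalue_def eigenvector_def by auto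
  \<comment> \<open>\<open>u\<close> is the adjoint of \<open>A\<close> applied to \<open>v\<close>,
    and \<open>S\<close> is the squared norm of \<open>v\<close>.\<close>
  define u where "u k = (\<Sum>i<n. cnj (A $$ (i, k)) * vec_index v i)" for k
  define S where "S = (\<Sum>i<n. (cmod (vec_index v i))\<^sup>2)"
  have row: "a * vec_index v i = (\<Sum>k<n. A $$ (i, k) * u k)" if i: "i < n" for i
  proof -
    have "a * vec_index v i = vec_index ((A * ?C) *\<^sub>v v) i"
      using v i by simp
    also have "\<dots> = (\<Sum>j<n. (A * ?C) $$ (i, j) * vec_index v j)"
      using A v(1) i by (auto simp: mult_mat_vec_def scalar_prod_def row_def intro!: sum.cong)
    also have "\<dots> = (\<Sum>j<n. \<Sum>k<n. A $$ (i, k) * cnj (A $$ (j, k)) * vec_index v j)"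
      using i by (auto simp: mat_mult_index[OF A C] sum_distrib_right intro!: sum.cong)
    also have "\<dots> = (\<Sum>k<n. A $$ (i, k) * u k)"
      by (subst sum.swap) (simp add: u_def sum_distrib_left mult.assoc)
    finally show ?thesis .
  qed
  have "a * complex_of_real S = (\<Sum>i<n. cnj (vec_index v i) * (a * vec_index v i))"
    unfolding S_def of_real_sum sum_distrib_left
    by (intro sum.cong refl) (simp only: complex_norm_square mult_ac)
  also have "\<dots> = (\<Sum>i<n. \<Sum>k<n. cnj (vec_index v i) * (A $$ (i, k) * u k))"
    using row by (auto simp: sum_distrib_left intro!: sum.cong)
  also have "\<dots> = (\<Sum>k<n. u k * cnj (u k))"
    by (subst sum.swap) (simp add: u_def[of _] sum_distrib_left sum_distrib_right mult_ac cnj_sum)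
  also have "\<dots> = complex_of_real (\<Sum>k<n. (cmod (u k))\<^sup>2)"
    by (simp add: complex_norm_square[symmetric])
  finally have eq: "a * complex_of_real S = complex_of_real (\<Sum>k<n. (cmod (u k))\<^sup>2)" .
  have "S > 0"
  proof -
    from v(1,2) obtain i where "i < n" "vec_index v i \<noteq> 0"
      by (metis carrier_vecD eq_vecI index_zero_vec)
    then show ?thesis unfolding S_def by (intro sum_pos2[where i = i]) auto
  qed
  then have "a = complex_of_real ((\<Sum>k<n. (cmod (u k))\<^sup>2) / S)"
    using eq by (simp add: field_simps)
  moreover have "(\<Sum>k<n. (cmod (u k))\<^sup>2) / S \<ge> 0"
    using \<open>S > 0\<close> by (simp add: sum_nonneg)
  ultimately show ?thesis by blast
qed

text \<open>The inequality of arithmetic and geometric means is applied to the eigenvalues of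
  \<open>H\<close>, the product of \<open>A\<close> with its adjoint: their product is the squared
  modulus of the determinant, and their sum is the trace, which is the sum of the squared moduli of
  all entries and so at most \<open>n^2 * b^2\<close>. The Schur form identifies product and sum of
  the eigenvalues with determinant and trace.\<close>

theorem Hadamard_inequality:
  fixes A :: "complex mat"
  assumes A: "A \<in> carrier_mat n n"
    and b: "\<And>i j. i < n \<Longrightarrow> j < n \<Longrightarrow> cmod (A $$ (i, j)) \<le> b"
  shows "cmod (det A) \<le> (b * sqrt n) ^ n"
proof (cases "n = 0")
  case True
  then show ?thesis using A by simp
next
  case False
  then have n: "n > 0" by simp
  have b0: "b \<ge> 0" using b[OF n n] norm_ge_zero order_trans by blast
  let ?C = "mat n n (\<lambda>(i, j). cnj (A $$ (j, i)))"
  have C: "?C \<in> carrier_mat n n" by simp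
  define H where "H = A * ?C"
  have H: "H \<in> carrier_mat n n" using A C by (simp add: H_def)
  interpret cnj_hom: comm_ring_hom cnj by unfold_locales auto
  have "?C = map_mat cnj (transpose_mat A)" using A by (auto intro!: eq_matI)
  then have "det ?C = cnj (det A)" using A by (simp add: cnj_hom.hom_det det_transpose)
  then have detH: "det H = complex_of_real ((cmod (det A))\<^sup>2)"
    unfolding H_def by (simp only: det_mult[OF A C] complex_norm_square)
  obtain as where as: "char_poly H = (\<Prod>a\<leftarrow>as. [:- a, 1:])" "length as = n"
    using char_poly_factorized[OF H] by blast
  obtain B P Q where schur: "schur_decomposition H as = (B, P, Q)" by (cases "schur_decomposition H as") auto
  from schur_decomposition[OF H as(1) schur]
  have B: "similar_mat_wit H B P Q" "upper_triangular B" "diag_mat B = as" by auto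
  note wit = similar_mat_witD2[OF H B(1)]
  have diag: "B $$ (i, i) = as ! i" if "i < n" for i
    using B(3) that wit(5) by (auto simp: diag_mat_def)
  have "det H = det B" using B(1) by (intro det_similar) (auto simp: similar_mat_def)
  also have "\<dots> = prod_list as" using det_upper_triangular[OF B(2) wit(5)] B(3) by simp
  also have "\<dots> = (\<Prod>i<n. as ! i)" by (simp add: prod.list_conv_set_nth as(2) atLeast0LessThan)
  finally have det_as: "det H = (\<Prod>i<n. as ! i)" .
  have "(\<Sum>i<n. H $$ (i, i)) = (\<Sum>i<n. (P * (B * Q)) $$ (i, i))"
    unfolding assoc_mult_mat[OF wit(6,5,7), symmetric] using wit(3) by simp
  also have "\<dots> = (\<Sum>i<n. (B * Q * P) $$ (i, i))"
    using wit by (intro trace_mult_commute) auto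
  also have "B * Q * P = B"
    unfolding assoc_mult_mat[OF wit(5,7,6)] wit(2) using wit(5) by simp
  finally have tr: "(\<Sum>i<n. H $$ (i, i)) = (\<Sum>i<n. as ! i)" using diag by simp
  have "\<exists>x\<ge>0. as ! i = complex_of_real x" if "i < n" for i
  proof -
    have "eigenvalue H (as ! i)"
      unfolding eigenvalue_root_char_poly[OF H] as(1)
      using that as(2) by (simp add: linear_poly_root)
    then show ?thesis using gram_eigenvalue_nonneg[OF A] by (simp add: H_def)
  qed
  then obtain x where x: "\<And>i. i < n \<Longrightarrow> 0 \<le> x i" "\<And>i. i < n \<Longrightarrow> as ! i = complex_of_real (x i)"
    by metis
  have "complex_of_real ((cmod (det A))\<^sup>2) = complex_of_real (\<Prod>i<n. x i)"
    using detH det_as x(2) by simp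
  then have prod: "(cmod (det A))\<^sup>2 = (\<Prod>i<n. x i)" using of_real_eq_iff by blast
  have "complex_of_real (\<Sum>i<n. x i) = (\<Sum>i<n. H $$ (i, i))" using tr x(2) by simp
  also have "\<dots> = (\<Sum>i<n. \<Sum>k<n. A $$ (i, k) * cnj (A $$ (i, k)))"
    unfolding H_def by (auto simp: mat_mult_index[OF A C] intro!: sum.cong)
  also have "\<dots> = complex_of_real (\<Sum>i<n. \<Sum>k<n. (cmod (A $$ (i, k)))\<^sup>2)"
    by (simp only: of_real_sum complex_norm_square)
  finally have "(\<Sum>i<n. x i) = (\<Sum>i<n. \<Sum>k<n. (cmod (A $$ (i, k)))\<^sup>2)" using of_real_eq_iff by blast
  also have "\<dots> \<le> (\<Sum>i<n. \<Sum>k<n. b\<^sup>2)"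
    using b by (intro sum_mono power_mono) auto
  finally have "(\<Sum>i<n. x i) / n \<le> n * b\<^sup>2" using n by (simp add: field_simps)
  then have "((\<Sum>i<n. x i) / n) ^ n \<le> (n * b\<^sup>2) ^ n"
    using x(1) by (intro power_mono) (auto intro!: divide_nonneg_nonneg sum_nonneg)
  also have "n * b\<^sup>2 = (b * sqrt n)\<^sup>2" by (simp add: power_mult_distrib)
  also have "((b * sqrt n)\<^sup>2) ^ n = ((b * sqrt n) ^ n)\<^sup>2"
    by (simp only: power_mult[symmetric] mult.commute)
  finally have "(cmod (det A))\<^sup>2 \<le> ((b * sqrt n) ^ n)\<^sup>2"
    using prod_le_power_mean[of n x, OF x(1) n] prod by linarith
  then show ?thesis using b0 by (auto intro: power2_le_imp_le)
qed

text \<open>In a square row echelon form the pivot of row \<open>i\<close> is in column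
  \<open>i\<close> or later, or the row is zero.\<close>

lemma upper_triangular_reduction:
  fixes A :: "'a :: field mat"
  assumes A: "A \<in> carrier_mat n n"
  shows "\<exists>P \<in> carrier_mat n n. det P \<noteq> 0 \<and> upper_triangular (P * A)"
proof -
  note gj = gauss_jordan_single[OF A refl]
  obtain P Q where P: "gauss_jordan_single A = P * A" "P \<in> carrier_mat n n" "Q \<in> carrier_mat n n" "P * Q = 1\<^sub>m n"
    using gj(4) by blast
  have PA: "P * A \<in> carrier_mat n n" using P A by auto
  obtain f where f: "pivot_fun (P * A) f n"
    using gj(3) PA unfolding P(1) row_echelon_form_def by auto
  have "upper_triangular (P * A)"
  proof (rule upper_triangularI)
    fix i j assume ij: "j < i" "i < dim_row (P * A)"
    then have i: "i < n" using PA by auto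
    have "f (0 + i) = n \<or> f (0 + i) \<ge> i + f 0"
      using pivot_bound[of "P * A" n f n 0 i] PA f i by auto
    then have "j < f i" using ij i by auto
    then show "(P * A) $$ (i, j) = 0"
      using f i PA unfolding pivot_fun_def Let_def by auto
  qed
  moreover have "det P \<noteq> 0"
    using det_mult[OF P(2,3)] P(4) by auto
  ultimately show ?thesis using P(2) by blast
qed

section \<open>Counting monomials\<close>

lemma finite_multisets_size_le: "finite {M :: 'a::finite multiset. size M \<le> m}"
proof -
  have "{M :: 'a multiset. size M \<le> m} \<subseteq> mset ` {xs. set xs \<subseteq> UNIV \<and> length xs \<le> m}"
  proof
    fix M :: "'a multiset" assume "M \<in> {M. size M \<le> m}"
    moreover obtain xs where xs: "M = mset xs" by (metis ex_mset)
    ultimately have "length xs \<le> m" by simp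
    then show "M \<in> mset ` {xs. set xs \<subseteq> UNIV \<and> length xs \<le> m}"
      unfolding xs by (intro imageI) simp
  qed
  then show ?thesis by (rule finite_subset) (intro finite_imageI finite_lists_length_le finite)
qed

text \<open>Stars and bars: the slack \<open>m - size M\<close>, added as one more multiplicity,
  turns the bound on the size into an exact sum over \<open>CARD('a) + 1\<close> slots.\<close>

lemma card_multisets_size_le:
  "card {M :: 'a::finite multiset. size M \<le> m} \<le> (m + CARD('a)) choose CARD('a)"
proof -
  obtain xs :: "'a list" where xs: "set xs = UNIV" "distinct xs"
    using finite_distinct_list[of "UNIV :: 'a set"] by auto
  then have len: "length xs = CARD('a)" using distinct_card by fastforce
  let ?f = "\<lambda>M. (m - size M) # map (count M) xs"
  let ?L = "{l :: nat list. length l = Suc CARD('a) \<and> sum_list l = m}"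
  have "inj_on ?f {M. size M \<le> m}"
    by (intro inj_onI multiset_eqI) (use xs in \<open>auto simp: map_eq_conv\<close>)
  moreover have "?f ` {M. size M \<le> m} \<subseteq> ?L"
  proof clarify
    fix M :: "'a multiset" assume "size M \<le> m"
    have "(\<Sum>x\<leftarrow>xs. count M x) = (\<Sum>x\<in>UNIV. count M x)"
      using xs by (simp add: sum_list_distinct_conv_sum_set)
    also have "\<dots> = size M"
      unfolding size_multiset_overloaded_eq
      by (rule sum.mono_neutral_right) (auto simp: not_in_iff)
    finally show "length (?f M) = Suc CARD('a) \<and> sum_list (?f M) = m"
      using \<open>size M \<le> m\<close> len by simp
  qed
  moreover have "finite ?L"
  proof (rule finite_subset)
    show "?L \<subseteq> {l. set l \<subseteq> {..m} \<and> length l = Suc CARD('a)}"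
      by (auto simp: member_le_sum_list)
  qed (simp add: finite_lists_length_eq)
  ultimately have "card {M :: 'a multiset. size M \<le> m} \<le> card ?L"
    by (meson card_inj_on_le)
  also have "\<dots> = (m + CARD('a)) choose m" by (simp add: card_length_sum_list)
  also have "\<dots> = (m + CARD('a)) choose CARD('a)" using binomial_symmetric[of m "m + CARD('a)"] by simp
  finally show ?thesis .
qed

text \<open>An enumeration of the monomials by degree. The first property lets triangular row
  operations remove all terms of lower degree. The second holds because the monomials numbered 0 to
  \<open>k\<close> all have degree at most \<open>size (q k)\<close>.\<close>

lemma exists_sorted_multisets:
  "\<exists>q :: nat \<Rightarrow> 'a::finite multiset.
     (\<forall>k<n. \<forall>M. size M < size (q k) \<longrightarrow> (\<exists>l<k. q l = M)) \<and>
     (\<forall>k<n. k < (size (q k) + CARD('a)) choose CARD('a))"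
proof -
  let ?S = "{M :: 'a multiset. size M \<le> n}"
  obtain xs where xs: "set xs = ?S" "distinct xs"
    using finite_distinct_list[OF finite_multisets_size_le] by blast
  define ys where "ys = sort_key size xs"
  have ys: "set ys = ?S" "distinct ys" "sorted (map size ys)" using xs by (auto simp: ys_def)
  \<comment> \<open>The powers of a single variable already provide \<open>n + 1\<close> monomials
    of degree at most \<open>n\<close>.\<close>
  have "n < length ys"
  proof -
    obtain a :: 'a where True by simp
    have "inj_on (\<lambda>k. replicate_mset k a) {..n}" by (metis (no_types, lifting) inj_onI size_replicate_mset)
    moreover have "(\<lambda>k. replicate_mset k a) ` {..n} \<subseteq> ?S" by auto
    ultimately have "card {..n} \<le> card ?S" using card_inj_on_le finite_multisets_size_le by blast
    also have "card ?S = length ys" using ys distinct_card by metis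
    finally show ?thesis by simp
  qed
  have mono: "size (ys ! k) \<le> size (ys ! l)" if "k \<le> l" "l < length ys" for k l
    using sorted_nth_mono[OF ys(3), of k l] that by simp
  show ?thesis
  proof (intro exI[of _ "\<lambda>k. ys ! k"] conjI allI impI)
    fix k and M :: "'a multiset" assume k: "k < n" and M: "size M < size (ys ! k)"
    have "ys ! k \<in> ?S" using k \<open>n < length ys\<close> ys(1) nth_mem[of k ys] by auto
    then have "M \<in> set ys" using M ys(1) by auto
    then obtain l where l: "l < length ys" "ys ! l = M" by (auto simp: in_set_conv_nth)
    then have "l < k" using mono[of k l] M by force
    with l show "\<exists>l<k. ys ! l = M" by blast
  next
    fix k assume k: "k < n"
    let ?m = "size (ys ! k)"
    have "inj_on (\<lambda>l. ys ! l) {..k}"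
      using ys(2) k \<open>n < length ys\<close> by (auto intro!: inj_onI simp: nth_eq_iff_index_eq)
    moreover have "(\<lambda>l. ys ! l) ` {..k} \<subseteq> {M. size M \<le> ?m}"
      using mono k \<open>n < length ys\<close> by auto
    ultimately have "card {..k} \<le> card {M :: 'a multiset. size M \<le> ?m}"
      using card_inj_on_le finite_multisets_size_le by blast
    then show "k < (?m + CARD('a)) choose CARD('a)"
      using card_multisets_size_le[where ?'a = 'a and m = ?m] by simp
  qed
qed

text \<open>Comparison of the sum with the integral of \<open>x powr p\<close>, one unit interval at
  a time by the mean value theorem; the intermediate point lies strictly below \<open>n + 1\<close>,
  which keeps the inequality strict. With \<open>p = 1 / d\<close> the denominator produces
  \<open>d / (d + 1)\<close>.\<close>

lemma sum_powr_gt: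
  fixes p :: real
  assumes p: "p > 0" and n: "n \<ge> 1"
  shows "(\<Sum>k<n. real (Suc k) powr p) > real n powr (p + 1) / (p + 1)"
  using n
proof (induction n rule: nat_induct_at_least)
  case base
  show ?case using p by simp
next
  case (Suc n)
  have "\<exists>z. real n < z \<and> z < real (Suc n) \<and>
      real (Suc n) powr (p + 1) - real n powr (p + 1) = (real (Suc n) - real n) * ((p + 1) * z powr p)"
    using Suc.hyps p
    by (intro MVT2) (auto intro!: derivative_eq_intros)
  then obtain z where z: "real n < z" "z < real (Suc n)"
    "real (Suc n) powr (p + 1) - real n powr (p + 1) = (p + 1) * z powr p" by auto
  then have eq: "real (Suc n) powr (p + 1) = real n powr (p + 1) + (p + 1) * z powr p" by linarith
  have "z powr p < real (Suc n) powr p" using z p by (intro powr_less_mono2) auto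
  moreover have "real (Suc n) powr (p + 1) / (p + 1) = real n powr (p + 1) / (p + 1) + z powr p"
    unfolding eq using p by (simp add: add_divide_distrib)
  ultimately have "real (Suc n) powr (p + 1) / (p + 1) < real n powr (p + 1) / (p + 1) + real (Suc n) powr p"
    by linarith
  with Suc.IH show ?case by simp
qed

text \<open>The binomial coefficient times \<open>d!\<close> is at most \<open>(s + d)^d\<close>;
  taking d-th roots costs the summand \<open>d\<close>.\<close>

lemma size_ge_of_binomial:
  assumes "k < (s + d) choose d" "d \<ge> 1"
  shows "(fact d) powr (1 / d) * real (Suc k) powr (1 / d) - d \<le> real s"
proof -
  have "Suc k * fact d \<le> ((s + d) choose d) * fact d" using assms by (intro mult_right_mono) auto
  also have "\<dots> \<le> (s + d) ^ d" by (rule binomial_fact_pow)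
  finally have "real (Suc k * fact d) \<le> real ((s + d) ^ d)" by (rule of_nat_mono)
  then have "fact d * real (Suc k) \<le> real (s + d) ^ d" by (simp add: algebra_simps)
  then have "(fact d * real (Suc k)) powr (1 / d) \<le> (real (s + d) ^ d) powr (1 / d)"
    by (intro powr_mono2) auto
  also have "\<dots> = real (s + d)"
    using assms(2) by (simp add: powr_realpow[symmetric] powr_powr)
  finally show ?thesis by (simp add: powr_mult)
qed

lemma sum_sizes_gt:
  fixes s :: "nat \<Rightarrow> nat"
  assumes s: "\<And>k. k < n \<Longrightarrow> k < (s k + d) choose d" and d: "d \<ge> 1" and n: "n \<ge> 1"
  shows "real n * (real d / (real d + 1) * fact d powr (1 / real d) * real n powr (1 / real d) - d)
    < (\<Sum>k<n. real (s k))"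
proof -
  let ?F = "(fact d :: real) powr (1 / d)"
  have "real n powr (1 / d + 1) = real n * real n powr (1 / d)" using n by (simp add: powr_add)
  moreover have "x / (1 / real d + 1) = x * (real d / (real d + 1))" for x :: real using d by (simp add: field_simps)
  ultimately have "real n * (real d / (real d + 1) * ?F * real n powr (1 / real d)) =
      ?F * (real n powr (1 / d + 1) / (1 / d + 1))"
    by (simp only: mult_ac)
  also have "\<dots> < ?F * (\<Sum>k<n. real (Suc k) powr (1 / d))"
    using d n by (intro mult_strict_left_mono sum_powr_gt) auto
  finally have "real n * (real d / (real d + 1) * ?F * real n powr (1 / real d) - d)
      < (\<Sum>k<n. ?F * real (Suc k) powr (1 / d) - d)"
    by (simp add: sum_subtractf sum_distrib_left algebra_simps)
  also have "\<dots> \<le> (\<Sum>k<n. real (s k))"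
    using s size_ge_of_binomial[OF _ d] by (intro sum_mono) auto
  finally show ?thesis .
qed

section \<open>Triangular bases from generalized eigenspaces\<close>

interpretation fun_vs: vector_space fun_scale
  by (rule vector_space_fun_scale)

text \<open>Linearity is asked for on \<open>V\<close> only: the transfer operator is an infinite
  sum, and its additivity rests on summability, which is available for members of
  \<open>U_space D\<close>.\<close>

locale linear_operator_on =
  fixes V :: "('a \<Rightarrow> complex) set" and L :: "('a \<Rightarrow> complex) \<Rightarrow> ('a \<Rightarrow> complex)"
  assumes subspace: "fun_vs.subspace V"
    and maps: "f \<in> V \<Longrightarrow> L f \<in> V"
    and add: "f \<in> V \<Longrightarrow> g \<in> V \<Longrightarrow> L (f + g) = L f + L g"
    and scale: "f \<in> V \<Longrightarrow> L (fun_scale a f) = fun_scale a (L f)"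
begin

definition shift :: "complex \<Rightarrow> ('a \<Rightarrow> complex) \<Rightarrow> ('a \<Rightarrow> complex)" where
  "shift \<mu> f = L f - fun_scale \<mu> f"

lemma linear_operator_on_shift: "linear_operator_on V (shift \<mu>)"
  by unfold_locales
    (auto simp: shift_def add scale subspace maps fun_vs.subspace_diff fun_vs.subspace_scale
      fun_vs.scale_right_distrib fun_vs.scale_right_diff_distrib mult.commute algebra_simps)

lemma linear_operator_on_power: "linear_operator_on V (L ^^ k)"
proof (induction k)
  case 0
  show ?case by unfold_locales (auto simp: subspace)
next
  case (Suc k)
  then interpret k: linear_operator_on V "L ^^ k" .
  show ?case
    by unfold_locales (simp_all only: funpow.simps comp_apply subspace maps k.maps add k.add scale k.scale)
qed

lemma zero: "L 0 = 0"
  using scale[OF fun_vs.subspace_0[OF subspace], of 0] by simp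

lemma power_shift_linear: "linear_operator_on V (shift \<mu> ^^ k)"
  by (rule linear_operator_on.linear_operator_on_power[OF linear_operator_on_shift])

lemma generalized_eigenspace_iff:
  "f \<in> generalized_eigenspace V L \<mu> \<longleftrightarrow> f \<in> V \<and> (\<exists>k. (shift \<mu> ^^ k) f = 0)"
  unfolding generalized_eigenspace_def shift_def[abs_def] by simp

lemma shift_power_mono:
  assumes "(shift \<mu> ^^ k) f = 0" "k \<le> l" shows "(shift \<mu> ^^ l) f = 0"
proof -
  have "(shift \<mu> ^^ l) f = (shift \<mu> ^^ (l - k)) ((shift \<mu> ^^ k) f)"
    using fun_cong[OF funpow_add[of "l - k" k "shift \<mu>"], of f] assms(2) by simp
  then show ?thesis using assms(1) linear_operator_on.zero[OF power_shift_linear] by simp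
qed

lemma subspace_generalized_eigenspace: "fun_vs.subspace (generalized_eigenspace V L \<mu>)"
proof (rule fun_vs.subspaceI)
  show "0 \<in> generalized_eigenspace V L \<mu>"
    unfolding generalized_eigenspace_iff
    using fun_vs.subspace_0[OF subspace] linear_operator_on.zero[OF power_shift_linear] by blast
next
  fix f g assume "f \<in> generalized_eigenspace V L \<mu>" "g \<in> generalized_eigenspace V L \<mu>"
  then obtain k l where "f \<in> V" "g \<in> V" and kl: "(shift \<mu> ^^ k) f = 0" "(shift \<mu> ^^ l) g = 0"
    unfolding generalized_eigenspace_iff by blast
  moreover have "(shift \<mu> ^^ max k l) (f + g) = 0"
    using shift_power_mono[OF kl(1), of "max k l"] shift_power_mono[OF kl(2), of "max k l"]
    by (simp add: linear_operator_on.add[OF power_shift_linear] \<open>f \<in> V\<close> \<open>g \<in> V\<close>)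
  ultimately show "f + g \<in> generalized_eigenspace V L \<mu>"
    unfolding generalized_eigenspace_iff using fun_vs.subspace_add[OF subspace] by blast
next
  fix a f assume "f \<in> generalized_eigenspace V L \<mu>"
  then obtain k where f: "f \<in> V" "(shift \<mu> ^^ k) f = 0"
    unfolding generalized_eigenspace_iff by blast
  then have "(shift \<mu> ^^ k) (fun_scale a f) = 0"
    by (simp add: linear_operator_on.scale[OF power_shift_linear])
  then show "fun_scale a f \<in> generalized_eigenspace V L \<mu>"
    unfolding generalized_eigenspace_iff using f fun_vs.subspace_scale[OF subspace] by blast
qed

text \<open>Modulo the span of its predecessors, \<open>f i\<close> is a non-zero eigenvector for
  \<open>\<nu> i\<close>. Thus \<open>L\<close> is triangular on a flag of invariant subspaces, with
  diagonal \<open>\<nu>\<close>.\<close>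

definition triangular :: "(nat \<Rightarrow> complex) \<Rightarrow> (nat \<Rightarrow> 'a \<Rightarrow> complex) \<Rightarrow> nat \<Rightarrow> bool" where
  "triangular \<nu> f j \<longleftrightarrow> (\<forall>i<j. f i \<in> V \<and> f i \<notin> fun_vs.span (f ` {..<i}) \<and>
     shift (\<nu> i) (f i) \<in> fun_vs.span (f ` {..<i}))"

lemma image_lessThan_Suc: "f ` {..<Suc j} = insert (f j) (f ` {..<j})"
  by (auto simp: lessThan_Suc)

lemma triangular_span_subset: "triangular \<nu> f j \<Longrightarrow> fun_vs.span (f ` {..<j}) \<subseteq> V"
  by (intro fun_vs.span_minimal subspace) (auto simp: triangular_def)

lemma triangular_Suc: "triangular \<nu> f (Suc j) \<Longrightarrow> triangular \<nu> f j"
  by (auto simp: triangular_def)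

text \<open>On the span of the first \<open>j + 1\<close> vectors modulo that of the first
  \<open>j\<close>, \<open>shift \<mu>\<close> is multiplication by \<open>\<nu> j - \<mu>\<close>.
  Invariance of the smaller span is a hypothesis because its own inductive proof uses this
  computation.\<close>

lemma triangular_step:
  assumes t: "triangular \<nu> f (Suc j)" and g: "g - fun_scale k (f j) \<in> fun_vs.span (f ` {..<j})"
    and inv: "\<And>h. h \<in> fun_vs.span (f ` {..<j}) \<Longrightarrow> shift \<mu> h \<in> fun_vs.span (f ` {..<j})"
  shows "shift \<mu> g - fun_scale ((\<nu> j - \<mu>) * k) (f j) \<in> fun_vs.span (f ` {..<j})"
proof -
  let ?E = "fun_vs.span (f ` {..<j})"
  interpret s: linear_operator_on V "shift \<mu>" by (rule linear_operator_on_shift)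
  have fj: "f j \<in> V" "shift (\<nu> j) (f j) \<in> ?E" using t by (auto simp: triangular_def)
  let ?h = "g - fun_scale k (f j)"
  have h: "?h \<in> V" using g triangular_span_subset[OF triangular_Suc[OF t]] by blast
  have "shift \<mu> g = shift \<mu> (?h + fun_scale k (f j))" by simp
  also have "\<dots> = shift \<mu> ?h + fun_scale k (shift \<mu> (f j))"
    using h fj(1) by (simp only: s.add s.scale fun_vs.subspace_scale[OF subspace])
  also have "shift \<mu> (f j) = shift (\<nu> j) (f j) + fun_scale (\<nu> j - \<mu>) (f j)"
    by (simp add: shift_def fun_vs.scale_left_diff_distrib)
  finally have "shift \<mu> g - fun_scale ((\<nu> j - \<mu>) * k) (f j) = shift \<mu> ?h + fun_scale k (shift (\<nu> j) (f j))"
    by (simp only: fun_vs.scale_right_distrib fun_vs.scale_scale mult.commute[of k] diff_eq_eq add.assoc)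
  then show ?thesis
    using inv[OF g] fj(2) by (simp add: fun_vs.span_add fun_vs.span_scale)
qed

lemma triangular_invariant:
  "triangular \<nu> f j \<Longrightarrow> g \<in> fun_vs.span (f ` {..<j}) \<Longrightarrow> shift \<mu> g \<in> fun_vs.span (f ` {..<j})"
proof (induction j arbitrary: g)
  case 0
  then have "g = 0" by simp
  then show ?case
    by (simp only: linear_operator_on.zero[OF linear_operator_on_shift] fun_vs.span_zero)
next
  case (Suc j)
  obtain k where k: "g - fun_scale k (f j) \<in> fun_vs.span (f ` {..<j})"
    using Suc.prems(2) unfolding image_lessThan_Suc fun_vs.span_breakdown_eq by blast
  from triangular_step[OF Suc.prems(1) k Suc.IH[OF triangular_Suc[OF Suc.prems(1)]]]
  show ?case unfolding image_lessThan_Suc fun_vs.span_breakdown_eq by blast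
qed

text \<open>Adding \<open>f j\<close> enlarges the intersection by at most one dimension, and only
  if \<open>\<nu> j = \<mu>\<close>: on the one-dimensional quotient the \<open>n\<close>-th power
  of the shift multiplies by \<open>(\<nu> j - \<mu>) ^ n\<close>, which must be zero once a
  generalized eigenvector has a non-zero component along \<open>f j\<close>.\<close>

lemma generalized_eigenspace_Int_span:
  "triangular \<nu> f j \<Longrightarrow> \<exists>B. finite B \<and> card B \<le> card {i. i < j \<and> \<nu> i = \<mu>} \<and>
     generalized_eigenspace V L \<mu> \<inter> fun_vs.span (f ` {..<j}) \<subseteq> fun_vs.span B"
proof (induction j)
  case 0
  show ?case by (intro exI[of _ "{}"]) auto
next
  case (Suc j)
  let ?G = "generalized_eigenspace V L \<mu>"
  let ?E = "fun_vs.span (f ` {..<j})"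
  let ?E' = "fun_vs.span (f ` {..<Suc j})"
  obtain B where B: "finite B" "card B \<le> card {i. i < j \<and> \<nu> i = \<mu>}" "?G \<inter> ?E \<subseteq> fun_vs.span B"
    using Suc.IH triangular_Suc[OF Suc.prems] by blast
  have fin: "finite {i. i < Suc j \<and> \<nu> i = \<mu>}" by simp
  show ?case
  proof (cases "?G \<inter> ?E' \<subseteq> ?E")
    case True
    have "card {i. i < j \<and> \<nu> i = \<mu>} \<le> card {i. i < Suc j \<and> \<nu> i = \<mu>}"
      by (rule card_mono[OF fin]) auto
    with True B show ?thesis by (intro exI[of _ B]) auto
  next
    case False
    then obtain g where g: "g \<in> ?G" "g \<in> ?E'" "g \<notin> ?E" by blast
    obtain k where k: "g - fun_scale k (f j) \<in> ?E"
      using g(2) unfolding image_lessThan_Suc fun_vs.span_breakdown_eq by blast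
    have k0: "k \<noteq> 0" using k g(3) by auto
    have fj: "f j \<notin> ?E" using Suc.prems by (auto simp: triangular_def)
    note tri = Suc.prems
    have inv: "h \<in> ?E \<Longrightarrow> shift \<mu> h \<in> ?E" for h
      using triangular_invariant[OF triangular_Suc[OF Suc.prems]] .
    have pow: "(shift \<mu> ^^ n) g - fun_scale ((\<nu> j - \<mu>) ^ n * k) (f j) \<in> ?E" for n
    proof (induction n)
      case 0
      show ?case using k by (simp only: funpow.simps power_0 mult_1 id_apply)
    next
      case (Suc n)
      from triangular_step[OF tri Suc.IH inv]
      show ?case by (simp only: funpow.simps comp_apply power_Suc mult.assoc)
    qed
    obtain n where "(shift \<mu> ^^ n) g = 0" using g(1) unfolding generalized_eigenspace_iff by blast
    with pow[of n] have "fun_scale ((\<nu> j - \<mu>) ^ n * k) (f j) \<in> ?E"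
      using fun_vs.span_neg by fastforce
    then have *: "fun_scale (inverse b) (fun_scale b (f j)) \<in> ?E" if "b = (\<nu> j - \<mu>) ^ n * k" for b
      unfolding that by (rule fun_vs.span_scale)
    have "(\<nu> j - \<mu>) ^ n * k = 0"
    proof (rule ccontr)
      assume nz: "(\<nu> j - \<mu>) ^ n * k \<noteq> 0"
      from *[OF refl] have "f j \<in> ?E"
        by (simp only: fun_vs.scale_scale left_inverse[OF nz] fun_vs.scale_one)
      with fj show False by blast
    qed
    then have \<nu>j: "\<nu> j = \<mu>" using k0 by simp
    then have "{i. i < Suc j \<and> \<nu> i = \<mu>} = insert j {i. i < j \<and> \<nu> i = \<mu>}" by auto
    then have card: "card {i. i < Suc j \<and> \<nu> i = \<mu>} = Suc (card {i. i < j \<and> \<nu> i = \<mu>})" by simp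
    have "?G \<inter> ?E' \<subseteq> fun_vs.span (insert g B)"
    proof
      fix h assume h: "h \<in> ?G \<inter> ?E'"
      then have "h \<in> ?E'" by blast
      then obtain k' where k': "h - fun_scale k' (f j) \<in> ?E"
        unfolding image_lessThan_Suc fun_vs.span_breakdown_eq by blast
      \<comment> \<open>The multiple of \<open>g\<close> is chosen to cancel the component of
        \<open>h\<close> along \<open>f j\<close>.\<close>
      have "h - fun_scale (k' / k) g = (h - fun_scale k' (f j)) - fun_scale (k' / k) (g - fun_scale k (f j))"
        using k0 by (simp add: fun_eq_iff fun_scale_def algebra_simps)
      then have "h - fun_scale (k' / k) g \<in> ?E"
        using k k' by (simp only: fun_vs.span_diff fun_vs.span_scale)
      moreover have "h - fun_scale (k' / k) g \<in> ?G"
        using h g(1) subspace_generalized_eigenspace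
        by (intro fun_vs.subspace_diff fun_vs.subspace_scale) auto
      ultimately have "h - fun_scale (k' / k) g \<in> fun_vs.span B" using B(3) by blast
      then show "h \<in> fun_vs.span (insert g B)" unfolding fun_vs.span_breakdown_eq by blast
    qed
    then show ?thesis
      using B(1,2) card by (intro exI[of _ "insert g B"]) (auto simp: card_insert_if)
  qed
qed

text \<open>The span so far meets the generalized eigenspace in at most as many dimensions as
  \<open>\<nu> j\<close> has been used. If this is below the multiplicity, some generalized
  eigenvector lies outside the span.\<close>

lemma triangular_extend:
  assumes t: "triangular \<nu> f j"
    and less: "card {i. i < j \<and> \<nu> i = \<nu> j} < algebraic_multiplicity V L (\<nu> j)"
  shows "\<exists>f. triangular \<nu> f (Suc j)"
proof -
  let ?\<mu> = "\<nu> j"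
  let ?G = "generalized_eigenspace V L ?\<mu>"
  let ?E = "fun_vs.span (f ` {..<j})"
  obtain B where B: "finite B" "card B \<le> card {i. i < j \<and> \<nu> i = ?\<mu>}" "?G \<inter> ?E \<subseteq> fun_vs.span B"
    using generalized_eigenspace_Int_span[OF t] by blast
  have "\<not> ?G \<subseteq> ?E"
  proof
    assume "?G \<subseteq> ?E"
    then have "fun_vs.dim ?G \<le> card B" using B by (intro fun_vs.dim_le_card) auto
    with B(2) less show False by (simp add: algebraic_multiplicity_def)
  qed
  then obtain g where g: "g \<in> ?G" "g \<notin> ?E" by blast
  then obtain n where n: "g \<in> V" "(shift ?\<mu> ^^ n) g = 0" unfolding generalized_eigenspace_iff by blast
  \<comment> \<open>The iterates of \<open>g\<close> under the shift end at 0, hence inside the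
    span. The last one outside it is the new basis vector: one more shift sends it into the
    span.\<close>
  define m where "m = (LEAST k. (shift ?\<mu> ^^ k) g \<in> ?E)"
  have m: "(shift ?\<mu> ^^ m) g \<in> ?E"
    unfolding m_def by (rule LeastI[where k = n]) (simp only: n fun_vs.span_zero)
  then have "m \<noteq> 0" using g(2) by (metis funpow_0)
  then obtain l where l: "m = Suc l" using not0_implies_Suc by blast
  define h where "h = (shift ?\<mu> ^^ l) g"
  have h: "h \<in> V" "h \<notin> ?E" "shift ?\<mu> h \<in> ?E"
    using n(1) m not_less_Least[of l "\<lambda>k. (shift ?\<mu> ^^ k) g \<in> ?E"]
    by (auto simp: h_def l linear_operator_on.maps[OF power_shift_linear] simp flip: m_def)
  define f' where "f' = f(j := h)"
  have f': "f' i = f i" "f' ` {..<i} = f ` {..<i}" if "i < j" for i using that by (auto simp: f'_def)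
  have f'j: "f' j = h" "f' ` {..<j} = f ` {..<j}" by (auto simp: f'_def)
  have "triangular \<nu> f' (Suc j)"
    unfolding triangular_def
  proof (intro allI impI)
    fix i assume "i < Suc j"
    then consider "i < j" | "i = j" by linarith
    then show "f' i \<in> V \<and> f' i \<notin> fun_vs.span (f' ` {..<i}) \<and> shift (\<nu> i) (f' i) \<in> fun_vs.span (f' ` {..<i})"
    proof cases
      case 1
      with t show ?thesis unfolding f'[OF 1] triangular_def by blast
    next
      case 2
      show ?thesis unfolding 2 f'j using h by blast
    qed
  qed
  then show ?thesis by blast
qed

text \<open>Decreasing moduli make every entry up to position \<open>n\<close> non-zero, so its
  multiplicity is the number of its occurrences. Position \<open>Suc j\<close> is itself an
  occurrence, hence the earlier ones are strictly fewer than the multiplicity and the flag can be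
  extended. The flag starts at index 0 and the sequence at 1.\<close>

lemma eigenvalue_sequence_triangular:
  assumes ev: "eigenvalue_sequence V L ev" and nz: "ev n \<noteq> 0" and "j \<le> n"
  shows "\<exists>f. triangular (\<lambda>i. ev (Suc i)) f j"
  using \<open>j \<le> n\<close>
proof (induction j)
  case 0
  show ?case by (simp add: triangular_def)
next
  case (Suc j)
  then obtain f where f: "triangular (\<lambda>i. ev (Suc i)) f j" by auto
  have "norm (ev n) \<le> norm (ev (Suc j))"
    using ev Suc.prems unfolding eigenvalue_sequence_def by auto
  then have "ev (Suc j) \<noteq> 0" using nz by auto
  then have fin: "finite {m. 1 \<le> m \<and> ev m = ev (Suc j)}"
    and card: "card {m. 1 \<le> m \<and> ev m = ev (Suc j)} = algebraic_multiplicity V L (ev (Suc j))"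
    using ev unfolding eigenvalue_sequence_def by blast+
  have "card {i. i < j \<and> ev (Suc i) = ev (Suc j)} = card (Suc ` {i. i < j \<and> ev (Suc i) = ev (Suc j)})"
    by (simp add: card_image)
  also have "\<dots> < card {m. 1 \<le> m \<and> ev m = ev (Suc j)}"
    by (rule psubset_card_mono[OF fin]) auto
  finally show ?case using triangular_extend[OF f] card by simp
qed

end

section \<open>The transfer operator\<close>

lemma continuous_on_of_approximable:
  fixes f :: "'a::topological_space \<Rightarrow> 'b::metric_space"
  assumes "\<And>e. e > 0 \<Longrightarrow> \<exists>g. continuous_on S g \<and> (\<forall>x\<in>S. dist (g x) (f x) \<le> e)"
  shows "continuous_on S f"
proof -
  have "\<forall>n. \<exists>g. continuous_on S g \<and> (\<forall>x\<in>S. dist (g x) (f x) \<le> inverse (real (Suc n)))"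
    using assms by simp
  then obtain g where g: "\<And>n. continuous_on S (g n)" "\<And>n x. x \<in> S \<Longrightarrow> dist (g n x) (f x) \<le> inverse (real (Suc n))"
    by metis
  show ?thesis
  proof (rule uniform_limit_theorem)
    show "uniform_limit S g f sequentially"
    proof (rule uniform_limitI)
      fix e :: real assume "e > 0"
      then have "\<forall>\<^sub>F n in sequentially. inverse (real (Suc n)) < e"
        by (rule order_tendstoD(2)[OF LIMSEQ_inverse_real_of_nat])
      then show "\<forall>\<^sub>F n in sequentially. \<forall>x\<in>S. dist (g n x) (f x) < e"
        by eventually_elim (use g(2) in \<open>auto intro: le_less_trans\<close>)
    qed
  qed (use g(1) in auto)
qed

lemma cont_holomorphic_bounded:
  fixes f :: "complex ^ 'n \<Rightarrow> complex"
  assumes "cont_holomorphic sc D f" "bounded D"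
  shows "bdd_above ((\<lambda>z. norm (f z)) ` closure D)"
proof -
  have "compact (closure D)" using assms(2) by (simp add: compact_closure)
  then have "compact ((\<lambda>z. norm (f z)) ` closure D)"
    using assms(1) unfolding cont_holomorphic_def
    by (intro compact_continuous_image continuous_on_norm) auto
  then show ?thesis by (intro bounded_imp_bdd_above compact_imp_bounded)
qed

lemma norm_le_U_norm:
  fixes f :: "complex ^ 'n \<Rightarrow> complex"
  assumes "cont_holomorphic sc D f" "bounded D" "z \<in> closure D"
  shows "norm (f z) \<le> U_norm D f"
  unfolding U_norm_def by (rule cSUP_upper[OF assms(3) cont_holomorphic_bounded[OF assms(1,2)]])

text \<open>The definition controls images of the open set \<open>D\<close>; continuity carries this
  to the closure, where the interpolation points live.\<close>

lemma holomorphic_map_system_image_closure: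
  assumes T: "holomorphic_map_system D I T" and "i \<in> I" "z \<in> closure D"
  shows "T i z \<in> closure (\<Union>i\<in>I. T i ` D)" "T i z \<in> D"
proof -
  have cont: "continuous_on (closure D) (T i)"
    using T \<open>i \<in> I\<close> by (auto simp: holomorphic_map_system_def cont_holomorphic_def)
  have "T i ` D \<subseteq> closure (\<Union>i\<in>I. T i ` D)"
    by (rule order_trans[OF _ closure_subset]) (use \<open>i \<in> I\<close> in blast)
  from image_closure_subset[OF cont closed_closure this]
  have "T i ` closure D \<subseteq> closure (\<Union>i\<in>I. T i ` D)" .
  then show "T i z \<in> closure (\<Union>i\<in>I. T i ` D)" using \<open>z \<in> closure D\<close> by blast
  then show "T i z \<in> D" using T unfolding holomorphic_map_system_def compactly_inside_def by blast
qed

lemma summable_on_tail: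
  fixes a :: "'i \<Rightarrow> real"
  assumes "a summable_on I" "e > 0"
  shows "\<exists>F. finite F \<and> F \<subseteq> I \<and> infsum a (I - F) < e"
proof -
  have "(sum a \<longlongrightarrow> infsum a I) (finite_subsets_at_top I)"
    using assms(1) by (simp add: has_sum_def[symmetric])
  then have "\<forall>\<^sub>F F in finite_subsets_at_top I. infsum a I - e < sum a F"
    using assms(2) by (intro order_tendstoD(1)) auto
  then obtain F where F: "finite F" "F \<subseteq> I" "infsum a I - e < sum a F"
    unfolding eventually_finite_subsets_at_top by blast
  have "infsum a (I - F) = infsum a I - infsum a F"
    using F assms(1) by (intro infsum_Diff) auto
  with F show ?thesis by (intro exI[of _ F]) simp
qed

context
  fixes D :: "(complex ^ 'n) set" and I :: "'i set"
    and T :: "'i \<Rightarrow> complex ^ 'n \<Rightarrow> complex ^ 'n" and w :: "'i \<Rightarrow> complex ^ 'n \<Rightarrow> complex"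
  assumes T: "holomorphic_map_system D I T" and w: "holomorphic_weight_system D I w"
begin

lemma domain: "bounded D" "open D"
  using T by (auto simp: holomorphic_map_system_def bounded_domain_def)

lemma weight_norm_le: "i \<in> I \<Longrightarrow> z \<in> closure D \<Longrightarrow> norm (w i z) \<le> U_norm D (w i)"
  using w domain by (intro norm_le_U_norm) (auto simp: holomorphic_weight_system_def)

lemma U_space_norm_le: "f \<in> U_space D \<Longrightarrow> z \<in> closure D \<Longrightarrow> norm (f z) \<le> U_norm D f"
  using domain by (intro norm_le_U_norm) (auto simp: U_space_def)

lemma term_norm_le:
  assumes "f \<in> U_space D" "i \<in> I" "z \<in> closure D"
  shows "norm (w i z * f (T i z)) \<le> U_norm D (w i) * U_norm D f"
  unfolding norm_mult
proof (rule mult_mono)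
  have "T i z \<in> closure D" using holomorphic_map_system_image_closure(2)[OF T assms(2,3)] closure_subset by blast
  then show "norm (f (T i z)) \<le> U_norm D f" using U_space_norm_le assms(1) by blast
  show "norm (w i z) \<le> U_norm D (w i)" using weight_norm_le assms by blast
  then show "0 \<le> U_norm D (w i)" by (rule order_trans[OF norm_ge_zero])
qed simp

lemma summable_bounds: "(\<lambda>i. U_norm D (w i) * M) summable_on I"
  using w by (intro summable_on_cmult_left) (simp add: holomorphic_weight_system_def)

lemma transfer_terms_summable:
  assumes "f \<in> U_space D" "z \<in> closure D"
  shows "(\<lambda>i. norm (w i z * f (T i z))) summable_on I" "(\<lambda>i. w i z * f (T i z)) summable_on I"
proof -
  show "(\<lambda>i. norm (w i z * f (T i z))) summable_on I"
    by (rule summable_on_comparison_test[OF summable_bounds])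
      (use term_norm_le assms in auto)
  then show "(\<lambda>i. w i z * f (T i z)) summable_on I" by (rule abs_summable_summable)
qed

lemma weights_summable:
  assumes "z \<in> closure D" shows "(\<lambda>i. norm (w i z)) summable_on I"
  by (rule summable_on_comparison_test[where f = "\<lambda>i. U_norm D (w i)"])
    (use weight_norm_le w assms in \<open>auto simp: holomorphic_weight_system_def\<close>)

text \<open>The Weierstrass M-test with majorants \<open>U_norm D (w i) * U_norm D f\<close>: one
  finite \<open>F\<close> serves all \<open>z\<close>, so continuity and holomorphy survive the
  limit.\<close>

lemma transfer_operator_approx:
  assumes f: "f \<in> U_space D" and e: "e > 0"
  shows "\<exists>F. finite F \<and> F \<subseteq> I \<and>
    (\<forall>z\<in>closure D. norm (transfer_operator D I T w f z - (\<Sum>i\<in>F. w i z * f (T i z))) \<le> e)"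
proof -
  obtain F where F: "finite F" "F \<subseteq> I" "(\<Sum>\<^sub>\<infinity>i\<in>I - F. U_norm D (w i) * U_norm D f) < e"
    using summable_on_tail[OF summable_bounds e] by blast
  have "norm (transfer_operator D I T w f z - (\<Sum>i\<in>F. w i z * f (T i z))) \<le> e" if z: "z \<in> closure D" for z
  proof -
    let ?a = "\<lambda>i. w i z * f (T i z)"
    have "transfer_operator D I T w f z - sum ?a F = infsum ?a (I - F)"
      using F z transfer_terms_summable(2)[OF f z]
      by (simp add: transfer_operator_def infsum_Diff)
    also have "norm \<dots> \<le> (\<Sum>\<^sub>\<infinity>i\<in>I - F. norm (?a i))"
      using transfer_terms_summable(1)[OF f z] by (intro norm_infsum_bound) (auto intro: summable_on_subset)
    also have "\<dots> \<le> (\<Sum>\<^sub>\<infinity>i\<in>I - F. U_norm D (w i) * U_norm D f)"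
      using transfer_terms_summable(1)[OF f z] term_norm_le[OF f _ z] summable_bounds
      by (intro infsum_mono) (auto intro: summable_on_subset)
    finally show ?thesis using F(3) by simp
  qed
  with F show ?thesis by blast
qed

lemma transfer_partial_sum_cont_holomorphic:
  assumes f: "f \<in> U_space D" and F: "F \<subseteq> I"
  shows "cont_holomorphic (*) D (\<lambda>z. \<Sum>i\<in>F. w i z * f (T i z))"
  unfolding cont_holomorphic_def
proof
  have wi: "cont_holomorphic (*) D (w i)" and Ti: "cont_holomorphic (*s) D (T i)" if "i \<in> F" for i
    using w T F that by (auto simp: holomorphic_weight_system_def holomorphic_map_system_def)
  have im: "T i ` closure D \<subseteq> D" if "i \<in> F" for i
    using holomorphic_map_system_image_closure(2)[OF T] F that by blast
  show "continuous_on (closure D) (\<lambda>z. \<Sum>i\<in>F. w i z * f (T i z))"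
  proof (intro continuous_on_sum continuous_on_mult)
    fix i assume i: "i \<in> F"
    show "continuous_on (closure D) (w i)" using wi[OF i] by (simp add: cont_holomorphic_def)
    show "continuous_on (closure D) (\<lambda>z. f (T i z))"
    proof (rule continuous_on_compose2[where t = "closure D"])
      show "T i ` closure D \<subseteq> closure D" using im[OF i] closure_subset by blast
    qed (use f Ti[OF i] in \<open>auto simp: U_space_def cont_holomorphic_def\<close>)
  qed
  show "holomorphic_multi (*) (\<lambda>z. \<Sum>i\<in>F. w i z * f (T i z)) D"
  proof (intro holomorphic_multi_sum holomorphic_multi_mult)
    fix i assume i: "i \<in> F"
    show "holomorphic_multi (*) (w i) D" using wi[OF i] by (simp add: cont_holomorphic_def)
    show "holomorphic_multi (*) (\<lambda>z. f (T i z)) D"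
    proof (rule holomorphic_multi_compose)
      show "T i ` D \<subseteq> D" using im[OF i] closure_subset by blast
    qed (use f Ti[OF i] in \<open>auto simp: U_space_def cont_holomorphic_def\<close>)
  qed
qed

lemma transfer_operator_in_U_space:
  assumes f: "f \<in> U_space D"
  shows "transfer_operator D I T w f \<in> U_space D"
  unfolding U_space_def cont_holomorphic_def
proof (intro CollectI conjI allI impI)
  let ?L = "transfer_operator D I T w f"
  have approx: "\<exists>g. cont_holomorphic (*) D g \<and> (\<forall>z\<in>closure D. norm (?L z - g z) \<le> e)" if "e > 0" for e
    using transfer_operator_approx[OF f that] transfer_partial_sum_cont_holomorphic[OF f] by meson
  show "continuous_on (closure D) ?L"
  proof (rule continuous_on_of_approximable)
    fix e :: real assume "e > 0"
    from approx[OF this] show "\<exists>g. continuous_on (closure D) g \<and> (\<forall>x\<in>closure D. dist (g x) (?L x) \<le> e)"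
      by (auto simp: cont_holomorphic_def dist_norm norm_minus_commute)
  qed
  show "holomorphic_multi (*) ?L D"
    unfolding holomorphic_multi_def
  proof
    fix z assume "z \<in> D"
    then obtain \<rho> where \<rho>: "\<rho> > 0" "ball z \<rho> \<subseteq> D" using domain(2) open_contains_ball by blast
    show "\<exists>f'. (?L has_derivative f') (at z) \<and> Vector_Spaces.linear (*s) (*) f'"
    proof (rule uniform_limit_holomorphic_derivative[OF \<rho>(1)])
      fix e :: real assume "e > 0"
      from approx[OF this] obtain g where g: "cont_holomorphic (*) D g" "\<And>z. z \<in> closure D \<Longrightarrow> norm (?L z - g z) \<le> e"
        by blast
      have "ball z \<rho> \<subseteq> closure D" using \<rho>(2) closure_subset by blast
      then show "\<exists>h. holomorphic_multi (*) h (ball z \<rho>) \<and> (\<forall>x\<in>ball z \<rho>. norm (?L x - h x) \<le> e)"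
        using g \<rho>(2) by (intro exI[of _ g]) (auto simp: cont_holomorphic_def intro: holomorphic_multi_subset)
    qed
  qed
qed (simp add: transfer_operator_def)

lemma subspace_U_space: "fun_vs.subspace (U_space D)"
proof (rule fun_vs.subspaceI)
  show "0 \<in> U_space D" by (simp add: U_space_def cont_holomorphic_def zero_fun_def)
  show "f + g \<in> U_space D" if "f \<in> U_space D" "g \<in> U_space D" for f g
    using that by (auto simp: U_space_def cont_holomorphic_def plus_fun_def
        intro: continuous_on_add holomorphic_multi_add)
  show "fun_scale a f \<in> U_space D" if "f \<in> U_space D" for a f
    using that by (auto simp: U_space_def cont_holomorphic_def fun_scale_def
        intro: continuous_on_mult_left holomorphic_multi_cmult)
qed

lemma linear_operator_on_transfer_operator:
  "linear_operator_on (U_space D) (transfer_operator D I T w)"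
proof
  show "transfer_operator D I T w (f + g) = transfer_operator D I T w f + transfer_operator D I T w g"
    if "f \<in> U_space D" "g \<in> U_space D" for f g
  proof
    fix z
    show "transfer_operator D I T w (f + g) z = (transfer_operator D I T w f + transfer_operator D I T w g) z"
      using infsum_add[OF transfer_terms_summable(2)[OF that(1), of z] transfer_terms_summable(2)[OF that(2), of z]]
      by (simp add: transfer_operator_def distrib_left)
  qed
  show "transfer_operator D I T w (fun_scale a f) = fun_scale a (transfer_operator D I T w f)"
    if "f \<in> U_space D" for f a
  proof
    fix z
    show "transfer_operator D I T w (fun_scale a f) z = fun_scale a (transfer_operator D I T w f) z"
      by (simp add: transfer_operator_def fun_scale_def mult.left_commute[of _ a] infsum_cmult_right')
  qed
qed (rule subspace_U_space transfer_operator_in_U_space | assumption)+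

end

section \<open>Determinant bounds\<close>

lemma permutes_less: "p permutes {0..<n} \<Longrightarrow> i < n \<Longrightarrow> p i < n" for n :: nat
  using permutes_in_image[of p "{0..<n}" i] by simp

lemma holomorphic_on_det:
  assumes "\<And>i j. i < n \<Longrightarrow> j < n \<Longrightarrow> (\<lambda>t. a t i j) holomorphic_on S"
  shows "(\<lambda>t. det (Matrix.mat n n (\<lambda>(i, j). a t i j))) holomorphic_on S"
proof -
  have "(\<lambda>t. \<Sum>p | p permutes {0..<n}. signof p * (\<Prod>i=0..<n. a t i (p i))) holomorphic_on S"
    by (intro holomorphic_intros assms) (auto simp: permutes_less)
  also have "(\<lambda>t. \<Sum>p | p permutes {0..<n}. signof p * (\<Prod>i=0..<n. a t i (p i))) =
      (\<lambda>t. det (Matrix.mat n n (\<lambda>(i, j). a t i j)))"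
    by (auto simp: det_def fun_eq_iff permutes_less intro!: sum.cong prod.cong)
  finally show ?thesis .
qed

lemma tendsto_det:
  fixes a :: "'b \<Rightarrow> nat \<Rightarrow> nat \<Rightarrow> complex"
  assumes "\<And>i j. i < n \<Longrightarrow> j < n \<Longrightarrow> ((\<lambda>t. a t i j) \<longlongrightarrow> b i j) F"
  shows "((\<lambda>t. det (Matrix.mat n n (\<lambda>(i, j). a t i j))) \<longlongrightarrow> det (Matrix.mat n n (\<lambda>(i, j). b i j))) F"
proof -
  have eq: "det (Matrix.mat n n (\<lambda>(i, j). c i j)) =
      (\<Sum>p | p permutes {0..<n}. signof p * (\<Prod>i=0..<n. c i (p i)))" for c :: "nat \<Rightarrow> nat \<Rightarrow> complex"
    by (auto simp: det_def permutes_less intro!: sum.cong prod.cong)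
  show ?thesis
    unfolding eq by (intro tendsto_intros assms) (auto simp: permutes_less)
qed

text \<open>Hadamard's inequality, in the form above, has one bound for all entries; here each row
  keeps its own bound, since the rows will carry different powers of \<open>t\<close>. The factorial
  ends up in the constant that the Schwarz lemma discards.\<close>

lemma norm_det_le_fact_prod:
  fixes A :: "complex mat"
  assumes A: "A \<in> carrier_mat n n"
    and b: "\<And>i j. i < n \<Longrightarrow> j < n \<Longrightarrow> norm (A $$ (i, j)) \<le> b i"
  shows "norm (det A) \<le> fact n * (\<Prod>i<n. b i)"
proof -
  have "norm (det A) \<le> (\<Sum>p | p permutes {0..<n}. norm (signof p * (\<Prod>i=0..<n. A $$ (i, p i))))"
    unfolding det_def'[OF A] by (rule norm_sum)
  also have "\<dots> \<le> (\<Sum>p | p permutes {0..<n}. (\<Prod>i<n. b i))"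
  proof (rule sum_mono)
    fix p assume "p \<in> {p. p permutes {0..<n}}"
    then have "norm (\<Prod>i=0..<n. A $$ (i, p i)) \<le> (\<Prod>i=0..<n. b i)"
      unfolding prod_norm[symmetric] using b by (intro prod_mono) (auto simp: permutes_less)
    then show "norm (signof p * (\<Prod>i=0..<n. A $$ (i, p i))) \<le> (\<Prod>i<n. b i)"
      by (simp add: norm_mult sign_def atLeast0LessThan)
  qed
  also have "\<dots> = fact n * (\<Prod>i<n. b i)" by (simp add: card_permutations)
  finally show ?thesis .
qed

lemma span_image_lessThan:
  fixes f :: "nat \<Rightarrow> 'a \<Rightarrow> complex"
  assumes "x \<in> fun_vs.span (f ` {..<n})"
  shows "\<exists>a. x = (\<lambda>z. \<Sum>l<n. a l * f l z)"
  using assms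
proof (induction n arbitrary: x)
  case 0
  then show ?case by (simp add: zero_fun_def)
next
  case (Suc n)
  then obtain k where "x - fun_scale k (f n) \<in> fun_vs.span (f ` {..<n})"
    by (auto simp: lessThan_Suc fun_vs.span_breakdown_eq)
  from Suc.IH[OF this] obtain a where a: "x - fun_scale k (f n) = (\<lambda>z. \<Sum>l<n. a l * f l z)" by blast
  have "x z = (\<Sum>l<Suc n. (a(n := k)) l * f l z)" for z
    using fun_cong[OF a, of z] by (simp add: fun_scale_def algebra_simps)
  then show ?case by (intro exI[of _ "a(n := k)"]) auto
qed

lemma sum_in_span_image:
  fixes f :: "nat \<Rightarrow> 'a \<Rightarrow> complex"
  assumes "\<And>z. x z = (\<Sum>l<n. a l * f l z)" shows "x \<in> fun_vs.span (f ` {..<n})"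
proof -
  have "x = (\<Sum>l<n. fun_scale (a l) (f l))"
  proof
    fix z
    have "(\<Sum>l<n. fun_scale (a l) (f l)) z = (\<Sum>l<n. a l * f l z)"
      by (induction n) (simp_all add: fun_scale_def)
    then show "x z = (\<Sum>l<n. fun_scale (a l) (f l)) z" using assms by simp
  qed
  then show ?thesis
    by (simp only:) (intro fun_vs.span_sum fun_vs.span_scale fun_vs.span_base, auto)
qed

section \<open>Evaluation matrices and interpolation points\<close>

abbreviation eval_mat :: "nat \<Rightarrow> (nat \<Rightarrow> 'a \<Rightarrow> complex) \<Rightarrow> (nat \<Rightarrow> 'a) \<Rightarrow> complex mat" where
  "eval_mat n f z \<equiv> Matrix.mat n n (\<lambda>(i, j). f i (z j))"

text \<open>Cofactors along column \<open>k\<close> do not see that column, so moving the point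
  \<open>z k\<close> changes the determinant as a fixed linear combination of the
  \<open>f i\<close>.\<close>

lemma det_eval_mat_update:
  assumes "k < n"
  shows "det (eval_mat n f (z(k := x))) = (\<Sum>i<n. f i x * cofactor (eval_mat n f z) i k)"
proof -
  have "cofactor (eval_mat n f (z(k := x))) i k = cofactor (eval_mat n f z) i k" if "i < n" for i
    using that assms unfolding cofactor_def mat_delete_def
    by (auto intro!: arg_cong[where f = det] eq_matI)
  then show ?thesis
    using laplace_expansion_column[of "eval_mat n f (z(k := x))" n k] assms by simp
qed

text \<open>Points are added one at a time. If no new point worked, the expansion along the new
  column, where \<open>f n\<close> has the previous non-zero determinant as coefficient, would put
  \<open>f n\<close> into the span of its predecessors. A point with non-zero determinant must lie
  in \<open>S\<close>, as all functions vanish elsewhere.\<close>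

lemma exists_det_eval_mat_nonzero:
  assumes "\<And>i. i < n \<Longrightarrow> f i \<notin> fun_vs.span (f ` {..<i})"
    and "\<And>i x. i < n \<Longrightarrow> x \<notin> S \<Longrightarrow> f i x = 0"
  shows "\<exists>z. (\<forall>j<n. z j \<in> S) \<and> det (eval_mat n f z) \<noteq> 0"
  using assms
proof (induction n)
  case 0
  show ?case by simp
next
  case (Suc n)
  then obtain z where z: "\<And>j. j < n \<Longrightarrow> z j \<in> S" "det (eval_mat n f z) \<noteq> 0" by (metis less_Suc_eq)
  let ?c = "\<lambda>i. cofactor (eval_mat (Suc n) f z) i n"
  have "mat_delete (eval_mat (Suc n) f z) n n = eval_mat n f z"
    by (auto simp: mat_delete_def intro!: eq_matI)
  then have cn: "?c n \<noteq> 0" using z(2) by (simp add: cofactor_def)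
  have "\<exists>x. (\<Sum>i<Suc n. f i x * ?c i) \<noteq> 0"
  proof (rule ccontr)
    assume "\<not> ?thesis"
    then have "f n x = (\<Sum>i<n. (- ?c i / ?c n) * f i x)" for x
      using cn by (simp add: field_simps sum_distrib_left[symmetric] eq_neg_iff_add_eq_0 sum_negf sum_divide_distrib[symmetric])
    then have "f n \<in> fun_vs.span (f ` {..<n})" by (rule sum_in_span_image)
    then show False using Suc.prems(1) by blast
  qed
  then obtain x where x: "(\<Sum>i<Suc n. f i x * ?c i) \<noteq> 0" by blast
  have "x \<in> S"
  proof (rule ccontr)
    assume "x \<notin> S"
    then have "f i x = 0" if "i < Suc n" for i using Suc.prems(2) that by blast
    then have "(\<Sum>i<Suc n. f i x * ?c i) = 0" by (intro sum.neutral) auto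
    with x show False by blast
  qed
  moreover have "det (eval_mat (Suc n) f (z(n := x))) \<noteq> 0"
    using x det_eval_mat_update[of n "Suc n" f z x] by simp
  ultimately show ?case using z(1) by (intro exI[of _ "z(n := x)"]) (auto simp: less_Suc_eq)
qed

text \<open>
  At points that nearly maximise the determinant, the Lagrange interpolation functions are bounded by a
  constant close to 1, as for Fekete points.
\<close>

lemma exists_lagrange_basis:
  assumes indep: "\<And>i. i < n \<Longrightarrow> f i \<notin> fun_vs.span (f ` {..<i})"
    and supp: "\<And>i x. i < n \<Longrightarrow> x \<notin> S \<Longrightarrow> f i x = 0"
    and B: "\<And>i x. i < n \<Longrightarrow> x \<in> S \<Longrightarrow> norm (f i x) \<le> B"
    and K: "K > 1"
  shows "\<exists>z N. (\<forall>j<n. z j \<in> S) \<and> N \<in> carrier_mat n n \<and>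
    N * eval_mat n f z = 1\<^sub>m n \<and>
    (\<forall>k<n. \<forall>x\<in>S. norm (\<Sum>i<n. N $$ (k, i) * f i x) \<le> K)"
proof -
  let ?Z = "{z. \<forall>j<n. z j \<in> S}"
  let ?d = "\<lambda>z. norm (det (eval_mat n f z))"
  have bdd: "bdd_above (?d ` ?Z)"
    by (rule bdd_aboveI2[where M = "(B * sqrt n) ^ n"], rule Hadamard_inequality[where n = n])
      (use B in auto)
  have "\<exists>z. (\<forall>j<n. z j \<in> S) \<and> det (eval_mat n f z) \<noteq> 0"
    by (rule exists_det_eval_mat_nonzero[OF indep supp])
  then obtain z0 where "\<forall>j<n. z0 j \<in> S" "det (eval_mat n f z0) \<noteq> 0" by blast
  then have z0: "z0 \<in> ?Z" "?d z0 > 0" by simp_all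
  define s where "s = (SUP z\<in>?Z. ?d z)"
  have s: "s \<ge> ?d z" if "z \<in> ?Z" for z unfolding s_def by (rule cSUP_upper[OF that bdd])
  have s0: "s > 0" using s[OF z0(1)] z0(2) by linarith
  then have "s / K < s" using K by (simp add: field_simps)
  \<comment> \<open>The supremum over \<open>S\<close> need not be attained; a point within the
    factor \<open>K\<close> of it is enough.\<close>
  then obtain z where z: "z \<in> ?Z" "s / K < ?d z"
    using less_cSUP_iff[OF _ bdd, of "s / K"] z0(1) unfolding s_def by blast
  let ?M = "eval_mat n f z"
  have dz: "?d z > 0" using z(2) s0 K by (smt (verit) divide_nonneg_pos)
  define N where "N = inverse (det ?M) \<cdot>\<^sub>m adj_mat ?M"
  have M: "?M \<in> carrier_mat n n" by simp
  note adj = adj_mat[OF M]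
  have N: "N \<in> carrier_mat n n" using adj(1) by (simp add: N_def)
  have "inverse (det ?M) \<cdot>\<^sub>m (det ?M \<cdot>\<^sub>m 1\<^sub>m n) = 1\<^sub>m n"
    using dz by (auto intro!: eq_matI)
  then have "N * ?M = 1\<^sub>m n"
    unfolding N_def mult_smult_assoc_mat[OF adj(1) M] adj(3) by simp
  moreover have "norm (\<Sum>i<n. N $$ (k, i) * f i x) \<le> K" if k: "k < n" and x: "x \<in> S" for k x
  proof -
    have "N $$ (k, i) = inverse (det ?M) * cofactor ?M i k" if "i < n" for i
      using k that by (simp add: N_def adj_mat_def)
    \<comment> \<open>Cramer's rule: the Lagrange function is a quotient of two evaluation
      determinants, so near maximality of the denominator bounds it by \<open>K\<close>.\<close>
    then have eq: "(\<Sum>i<n. N $$ (k, i) * f i x) = det (eval_mat n f (z(k := x))) / det ?M"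
      unfolding det_eval_mat_update[OF k] by (simp add: sum_divide_distrib field_simps)
    have "?d (z(k := x)) \<le> K * ?d z"
    proof -
      have "?d (z(k := x)) \<le> s" by (rule s) (use z(1) x in auto)
      also have "\<dots> \<le> K * ?d z" using z(2) K by (simp add: field_simps)
      finally show ?thesis .
    qed
    then show ?thesis unfolding eq norm_divide using dz by (simp only: pos_divide_le_eq)
  qed
  ultimately show ?thesis using z(1) N by blast
qed

text \<open>
  Row operations turn the \<open>k\<close>-th row into one vanishing at \<open>t = 0\<close> to the order of the \<open>k\<close>-th monomial.
\<close>

lemma det_slices_bound:
  fixes g :: "nat \<Rightarrow> complex ^ 'n \<Rightarrow> complex" and v :: "'i \<Rightarrow> nat \<Rightarrow> complex ^ 'n"
    and a :: "'i \<Rightarrow> nat \<Rightarrow> complex" and q :: "nat \<Rightarrow> 'n multiset"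
  assumes hol: "\<And>k. k < n \<Longrightarrow> holomorphic_multi (*) (g k) (ball c R)" and R: "R > 0"
    and B: "\<And>k z. k < n \<Longrightarrow> z \<in> ball c R \<Longrightarrow> norm (g k z) \<le> B" and B0: "B \<ge> 0"
    and v: "\<And>i j. i \<in> F \<Longrightarrow> j < n \<Longrightarrow> norm (v i j) \<le> R"
    and a: "\<And>j. j < n \<Longrightarrow> (\<Sum>i\<in>F. norm (a i j)) \<le> W"
    and q: "\<And>k M. k < n \<Longrightarrow> size M < size (q k) \<Longrightarrow> \<exists>l<k. q l = M"
    and t: "t \<in> ball 0 1 - {0}"
  shows "norm (det (Matrix.mat n n (\<lambda>(k, j). \<Sum>i\<in>F. a i j * g k (c + t *s v i j))))
    \<le> (W * B * sqrt n) ^ n * norm t ^ (\<Sum>k<n. size (q k))"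
proof -
  define X where "X t = Matrix.mat n n (\<lambda>(k, j). \<Sum>i\<in>F. a i j * g k (c + t *s v i j))" for t
  have X: "X t \<in> carrier_mat n n" for t by (simp add: X_def)
  have in_ball: "c + t *s v i j \<in> ball c R" if "t \<in> ball 0 1" "i \<in> F" "j < n" for t i j
  proof -
    have "norm t * norm (v i j) \<le> norm t * R" using v[OF that(2,3)] by (intro mult_left_mono) auto
    also have "\<dots> < R" using that(1) R by simp
    finally show ?thesis by (simp add: dist_norm norm_vector_scalar_mult)
  qed
  have weighted: "norm (\<Sum>i\<in>F. a i j * y i) \<le> W * b" if "j < n" "b \<ge> 0" "\<And>i. i \<in> F \<Longrightarrow> norm (y i) \<le> b" for j y b
  proof -
    have "norm (\<Sum>i\<in>F. a i j * y i) \<le> (\<Sum>i\<in>F. norm (a i j) * b)"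
      by (rule sum_norm_le) (use that in \<open>auto simp: norm_mult intro: mult_left_mono\<close>)
    also have "\<dots> \<le> W * b" unfolding sum_distrib_right[symmetric] using a that by (intro mult_right_mono) auto
    finally show ?thesis .
  qed
  obtain P where P: "P \<in> carrier_mat n n" "det P \<noteq> 0"
    "upper_triangular (P * Matrix.mat n n (\<lambda>(k, l). taylor_functional c (q l) (g k)))"
    using upper_triangular_reduction[of "Matrix.mat n n (\<lambda>(k, l). taylor_functional c (q l) (g k))" n] by auto
  have A0: "Matrix.mat n n (\<lambda>(k, l). taylor_functional c (q l) (g k)) \<in> carrier_mat n n" by simp
  \<comment> \<open>The reduced rows: \<open>P\<close> makes the matrix of Taylor coefficients of
    the \<open>h k\<close> upper triangular.\<close>
  define h where "h k z = (\<Sum>i<n. P $$ (k, i) * g i z)" for k z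
  have hol_h: "holomorphic_multi (*) (h k) (ball c R)" for k
    unfolding h_def[abs_def] by (intro holomorphic_multi_sum holomorphic_multi_cmult hol) auto
  have tf: "taylor_functional c M (h k) = 0" if kM: "k < n" "size M < size (q k)" for k M
  proof -
    \<comment> \<open>The ordering of the monomials places \<open>M\<close> in a column left of
      \<open>k\<close>, where the triangular matrix is zero.\<close>
    obtain l where l: "l < k" "q l = M" using q[OF kM] by blast
    have "taylor_functional c M (h k) = (\<Sum>i<n. P $$ (k, i) * taylor_functional c M (g i))"
      by (rule taylor_functional_sum_cmult[where S = "ball c R"]) (use hol R in \<open>auto simp: h_def\<close>)
    also have "\<dots> = (P * Matrix.mat n n (\<lambda>(k, l). taylor_functional c (q l) (g k))) $$ (k, l)"
      using l kM(1) by (subst mat_mult_index[OF P(1) A0 kM(1)]) auto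
    also have "\<dots> = 0" using P(1,3) l kM by (intro upper_triangularD) auto
    finally show ?thesis .
  qed
  define Bh where "Bh k = (\<Sum>i<n. norm (P $$ (k, i)) * B)" for k
  have Bh: "norm (h k z) \<le> Bh k" if "z \<in> ball c R" for k z
    unfolding h_def Bh_def
    by (rule sum_norm_le) (use B that in \<open>auto simp: norm_mult intro!: mult_left_mono\<close>)
  have Bh0: "Bh k \<ge> 0" for k unfolding Bh_def using B0 by (intro sum_nonneg) auto
  have "norm (det (X t)) \<le> (W * B * sqrt n) ^ n * norm t ^ (\<Sum>k<n. size (q k))"
  proof (rule Schwarz_power[OF _ _ _ t])
    show "(\<lambda>t. det (X t)) holomorphic_on ball 0 1"
      unfolding X_def
      by (intro holomorphic_on_det holomorphic_intros holomorphic_on_slice[OF hol]) (auto intro: in_ball simp del: mem_ball)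
  next
    fix s :: complex assume s: "s \<in> ball 0 1 - {0}"
    show "norm (det (X s)) \<le> (W * B * sqrt n) ^ n"
    proof (rule Hadamard_inequality[OF X])
      fix k j assume kj: "k < n" "j < n"
      have "norm (\<Sum>i\<in>F. a i j * g k (c + s *s v i j)) \<le> W * B"
        by (intro weighted kj B0 B in_ball) (use s in auto)
      then show "norm (X s $$ (k, j)) \<le> W * B" using kj by (simp add: X_def)
    qed
    have PX: "norm ((P * X s) $$ (k, j)) \<le> W * (Bh k * norm s ^ size (q k))" if kj: "k < n" "j < n" for k j
    proof -
      have "(P * X s) $$ (k, j) = (\<Sum>l<n. P $$ (k, l) * (\<Sum>i\<in>F. a i j * g l (c + s *s v i j)))"
        using kj by (subst mat_mult_index[OF P(1) X]) (auto simp: X_def)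
      also have "\<dots> = (\<Sum>i\<in>F. a i j * h k (c + s *s v i j))"
        unfolding h_def sum_distrib_left by (subst sum.swap) (simp add: mult.left_commute)
      also have "norm \<dots> \<le> W * (Bh k * norm s ^ size (q k))"
      proof (rule weighted[OF kj(2)])
        show "norm (h k (c + s *s v i j)) \<le> Bh k * norm s ^ size (q k)" if "i \<in> F" for i
          by (rule slice_bound_of_vanishing_taylor[OF hol_h Bh tf[OF kj(1)] v[OF that kj(2)] R]) (use s in auto)
      qed (use Bh0 in auto)
      finally show ?thesis .
    qed
    \<comment> \<open>\<open>det P\<close> is a non-zero constant independent of \<open>s\<close>,
      so the order of vanishing read off from the reduced rows belongs to \<open>det (X s)\<close>
      as well.\<close>
    have "norm (det P) * norm (det (X s)) = norm (det (P * X s))"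
      by (simp add: det_mult[OF P(1) X] norm_mult)
    also have "\<dots> \<le> fact n * (\<Prod>k<n. W * (Bh k * norm s ^ size (q k)))"
      by (rule norm_det_le_fact_prod) (use P X PX in auto)
    also have "\<dots> = fact n * (\<Prod>k<n. W * Bh k) * norm s ^ (\<Sum>k<n. size (q k))"
      by (simp add: prod.distrib power_sum)
    finally show "norm (det (X s)) \<le> (fact n * (\<Prod>k<n. W * Bh k) / norm (det P)) * norm s ^ (\<Sum>k<n. size (q k))"
      using P(2) by (simp add: field_simps)
  qed
  then show ?thesis by (simp add: X_def)
qed

section \<open>The determinant of the transfer operator on an invariant subspace\<close>

lemma det_conjugated_triangular:
  fixes M N C :: "complex mat"
  assumes "M \<in> carrier_mat n n" "N \<in> carrier_mat n n" "C \<in> carrier_mat n n" "N * M = 1\<^sub>m n"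
    and "\<And>i j. i < j \<Longrightarrow> j < n \<Longrightarrow> C $$ (i, j) = 0"
  shows "det (N * (C * M)) = (\<Prod>i<n. C $$ (i, i))"
proof -
  have "det N * det M = 1" using det_mult[OF assms(2,1)] assms(4) by simp
  moreover have "det C = (\<Prod>i<n. C $$ (i, i))"
    using det_lower_triangular[OF assms(5) assms(3)] assms(3)
    by (simp add: diag_mat_def prod.list_conv_set_nth atLeast0LessThan)
  ultimately show ?thesis using assms by (simp add: det_mult[of _ n] mult.commute)
qed

context
  fixes D :: "(complex ^ 'n) set" and I :: "'i set"
    and T :: "'i \<Rightarrow> complex ^ 'n \<Rightarrow> complex ^ 'n" and w :: "'i \<Rightarrow> complex ^ 'n \<Rightarrow> complex"
  assumes T: "holomorphic_map_system D I T" and w: "holomorphic_weight_system D I w"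
begin

text \<open>Interpolation points may lie on the boundary, while the supremum runs over the open set;
  finite sums of the weights are continuous on the closure, so the bound extends. The summable norms
  \<open>U_norm D (w i)\<close> keep the supremum finite.\<close>

lemma weight_sum_le:
  assumes z: "z \<in> closure D" and F: "finite F" "F \<subseteq> I"
  shows "(\<Sum>i\<in>F. norm (w i z)) \<le> (SUP z\<in>D. \<Sum>\<^sub>\<infinity>i\<in>I. norm (w i z))"
proof (rule continuous_le_on_closure[OF _ z])
  show "continuous_on (closure D) (\<lambda>z. \<Sum>i\<in>F. norm (w i z))"
    using w F(2) by (intro continuous_on_sum continuous_on_norm)
      (auto simp: holomorphic_weight_system_def cont_holomorphic_def)
  fix x assume x: "x \<in> D"
  have cl: "y \<in> D \<Longrightarrow> y \<in> closure D" for y using closure_subset by blast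
  have "(\<Sum>i\<in>F. norm (w i x)) = (\<Sum>\<^sub>\<infinity>i\<in>F. norm (w i x))" using F(1) by simp
  also have "\<dots> \<le> (\<Sum>\<^sub>\<infinity>i\<in>I. norm (w i x))"
    using F weights_summable[OF T w cl[OF x]] by (intro infsum_mono_neutral) auto
  also have "\<dots> \<le> (SUP z\<in>D. \<Sum>\<^sub>\<infinity>i\<in>I. norm (w i z))"
  proof (rule cSUP_upper[OF x bdd_aboveI2])
    fix y assume "y \<in> D"
    then show "(\<Sum>\<^sub>\<infinity>i\<in>I. norm (w i y)) \<le> (\<Sum>\<^sub>\<infinity>i\<in>I. U_norm D (w i))"
      using weights_summable[OF T w cl] weight_norm_le[OF T w _ cl] w
      by (intro infsum_mono) (auto simp: holomorphic_weight_system_def)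
  qed
  finally show "(\<Sum>i\<in>F. norm (w i x)) \<le> (SUP z\<in>D. \<Sum>\<^sub>\<infinity>i\<in>I. norm (w i z))" .
qed

lemma transfer_operator_tendsto:
  assumes "f \<in> U_space D" "z \<in> closure D"
  shows "((\<lambda>F. \<Sum>i\<in>F. w i z * f (T i z)) \<longlongrightarrow> transfer_operator D I T w f z) (finite_subsets_at_top I)"
  using has_sum_infsum[OF transfer_terms_summable(2)[OF T w assms]] assms(2)
  by (simp add: has_sum_def transfer_operator_def)

end

text \<open>The values of \<open>L g k\<close> at the points \<open>z j\<close> form the matrix
  \<open>G\<close> of the operator in the Lagrange basis. Since \<open>N\<close> inverts the
  evaluation matrix, \<open>G\<close> is similar to the triangular matrix \<open>C\<close> with
  diagonal \<open>\<nu>\<close>, which makes the product of the \<open>\<nu> i\<close> its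
  determinant.\<close>

lemma triangular_det_bound:
  fixes D :: "(complex ^ 'n) set" and q :: "nat \<Rightarrow> 'n multiset" and I :: "'i set"
    and T :: "'i \<Rightarrow> complex ^ 'n \<Rightarrow> complex ^ 'n" and w :: "'i \<Rightarrow> complex ^ 'n \<Rightarrow> complex"
  assumes T: "holomorphic_map_system D I T" and w: "holomorphic_weight_system D I w"
    and R: "R > 0" and D: "D = ball c R" and r: "0 < r" "r < 1"
    and img: "(\<Union>i\<in>I. T i ` D) \<subseteq> ball c (r * R)"
    and tri: "linear_operator_on.triangular (U_space D) (transfer_operator D I T w) \<nu> f n"
    and q: "\<And>k M. k < n \<Longrightarrow> size M < size (q k) \<Longrightarrow> \<exists>l<k. q l = M"
    and K: "K > 1"
  shows "norm (\<Prod>i<n. \<nu> i) \<le>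
    ((SUP z\<in>D. \<Sum>\<^sub>\<infinity>i\<in>I. norm (w i z)) * K * sqrt n) ^ n * r ^ (\<Sum>k<n. size (q k))"
proof -
  let ?L = "transfer_operator D I T w" and ?S = "closure D"
  let ?W = "SUP z\<in>D. \<Sum>\<^sub>\<infinity>i\<in>I. norm (w i z)"
  interpret linear_operator_on "U_space D" ?L by (rule linear_operator_on_transfer_operator[OF T w])
  have f: "f i \<in> U_space D" "f i \<notin> fun_vs.span (f ` {..<i})"
    "?L (f i) - fun_scale (\<nu> i) (f i) \<in> fun_vs.span (f ` {..<i})" if "i < n" for i
    using tri that unfolding triangular_def shift_def by blast+
  have supp: "f i x = 0" if "i < n" "x \<notin> ?S" for i x using f(1)[OF that(1)] that(2) by (simp add: U_space_def)
  have bound: "norm (f i x) \<le> Max (insert 0 ((\<lambda>i. U_norm D (f i)) ` {..<n}))" if "i < n" "x \<in> ?S" for i x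
    using U_space_norm_le[OF T w f(1)[OF that(1)] that(2)] that(1) by (auto simp: Max_ge_iff)
  have "\<exists>z N. (\<forall>j<n. z j \<in> ?S) \<and> N \<in> carrier_mat n n \<and>
    N * eval_mat n f z = 1\<^sub>m n \<and>
    (\<forall>k<n. \<forall>x\<in>?S. norm (\<Sum>i<n. N $$ (k, i) * f i x) \<le> K)"
    by (rule exists_lagrange_basis[OF f(2) supp bound K])
  then obtain z N where zN: "(\<forall>j<n. z j \<in> ?S) \<and> N \<in> carrier_mat n n \<and>
    N * eval_mat n f z = 1\<^sub>m n \<and>
    (\<forall>k<n. \<forall>x\<in>?S. norm (\<Sum>i<n. N $$ (k, i) * f i x) \<le> K)"
    by (elim exE) (rule that)
  then have z: "\<And>j. j < n \<Longrightarrow> z j \<in> ?S" and N: "N \<in> carrier_mat n n" "N * eval_mat n f z = 1\<^sub>m n"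
    and NK: "\<And>k x. k < n \<Longrightarrow> x \<in> ?S \<Longrightarrow> norm (\<Sum>i<n. N $$ (k, i) * f i x) \<le> K"
    by simp_all
  define g where "g k x = (\<Sum>i<n. N $$ (k, i) * f i x)" for k x
  have gK: "norm (g k x) \<le> K" if "k < n" "x \<in> ?S" for k x using NK[OF that] by (simp add: g_def)
  have DS: "D \<subseteq> ?S" by (rule closure_subset)
  have hol_g: "holomorphic_multi (*) (g k) (ball c R)" if "k < n" for k
    unfolding g_def[abs_def]
    by (intro holomorphic_multi_sum holomorphic_multi_cmult)
      (use f(1) D in \<open>auto simp: U_space_def cont_holomorphic_def\<close>)
  \<comment> \<open>Rescaled so that \<open>t = r\<close> gives \<open>T i (z j)\<close>. As
    \<open>z j\<close> may be a boundary point, its image is known to lie only in the closed ball of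
    radius \<open>r * R\<close>, so the norm of \<open>v i j\<close> is at most \<open>R\<close>,
    possibly equal.\<close>
  define v where "v i j = complex_of_real (1 / r) *s (T i (z j) - c)" for i j
  have "closure (\<Union>i\<in>I. T i ` D) \<subseteq> cball c (r * R)"
    by (rule closure_minimal) (use img ball_subset_cball in blast)+
  then have Tz: "T i (z j) \<in> cball c (r * R)" if "i \<in> I" "j < n" for i j
    using holomorphic_map_system_image_closure(1)[OF T that(1) z[OF that(2)]] by blast
  have v: "norm (v i j) \<le> R" if "i \<in> I" "j < n" for i j
  proof -
    have "norm (v i j) = norm (T i (z j) - c) / r"
      unfolding v_def norm_vector_scalar_mult using r by (simp add: norm_divide)
    also have "\<dots> \<le> r * R / r"
      using Tz[OF that] r by (intro divide_right_mono) (auto simp: dist_norm norm_minus_commute)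
    finally show ?thesis using r by simp
  qed
  have rv: "c + complex_of_real r *s v i j = T i (z j)" for i j
    using r by (simp add: v_def Finite_Cartesian_Product.vec_eq_iff)
  \<comment> \<open>The estimate is made for finite partial sums with a bound independent of
    \<open>F\<close>; it passes to the limit because a determinant is continuous in its
    entries.\<close>
  have fin: "norm (det (Matrix.mat n n (\<lambda>(k, j). \<Sum>i\<in>F. w i (z j) * g k (T i (z j)))))
      \<le> (?W * K * sqrt n) ^ n * r ^ (\<Sum>k<n. size (q k))" if F: "finite F" "F \<subseteq> I" for F
  proof -
    have "norm (det (Matrix.mat n n (\<lambda>(k, j). \<Sum>i\<in>F. w i (z j) * g k (c + complex_of_real r *s v i j))))
      \<le> (?W * K * sqrt n) ^ n * norm (complex_of_real r) ^ (\<Sum>k<n. size (q k))"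
    proof (rule det_slices_bound[OF hol_g R])
      show "norm (g k x) \<le> K" if "k < n" "x \<in> ball c R" for k x
        using gK that D DS by blast
      show "(\<Sum>i\<in>F. norm (w i (z j))) \<le> ?W" if "j < n" for j
        by (rule weight_sum_le[OF T w z[OF that] F])
      show "norm (v i j) \<le> R" if "i \<in> F" "j < n" for i j using v that F by blast
    qed (use q K r in auto)
    then show ?thesis using r by (simp add: rv)
  qed
  define G where "G = Matrix.mat n n (\<lambda>(k, j). \<Sum>i<n. N $$ (k, i) * ?L (f i) (z j))"
  have "((\<lambda>F. \<Sum>i\<in>F. w i (z j) * g k (T i (z j))) \<longlongrightarrow> (\<Sum>i<n. N $$ (k, i) * ?L (f i) (z j)))
      (finite_subsets_at_top I)" if "j < n" for k j
  proof -
    have "((\<lambda>F. \<Sum>l<n. N $$ (k, l) * (\<Sum>i\<in>F. w i (z j) * f l (T i (z j)))) \<longlongrightarrow>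
        (\<Sum>l<n. N $$ (k, l) * ?L (f l) (z j))) (finite_subsets_at_top I)"
      by (intro tendsto_intros transfer_operator_tendsto[OF T w f(1) z[OF that]]) auto
    also have "(\<lambda>F. \<Sum>l<n. N $$ (k, l) * (\<Sum>i\<in>F. w i (z j) * f l (T i (z j)))) =
        (\<lambda>F. \<Sum>i\<in>F. w i (z j) * g k (T i (z j)))"
      unfolding g_def sum_distrib_left by (subst sum.swap) (simp add: mult.left_commute)
    finally show ?thesis .
  qed
  then have "((\<lambda>F. det (Matrix.mat n n (\<lambda>(k, j). \<Sum>i\<in>F. w i (z j) * g k (T i (z j))))) \<longlongrightarrow> det G)
      (finite_subsets_at_top I)"
    unfolding G_def by (intro tendsto_det)
  then have "((\<lambda>F. norm (det (Matrix.mat n n (\<lambda>(k, j). \<Sum>i\<in>F. w i (z j) * g k (T i (z j)))))) \<longlongrightarrow> norm (det G))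
      (finite_subsets_at_top I)"
    by (rule tendsto_norm)
  then have detG: "norm (det G) \<le> (?W * K * sqrt n) ^ n * r ^ (\<Sum>k<n. size (q k))"
    by (rule tendsto_upperbound) (use fin in \<open>auto intro: eventually_finite_subsets_at_top_weakI\<close>)
  have "\<exists>a. \<forall>x. ?L (f i) x - \<nu> i * f i x = (\<Sum>l<i. a l * f l x)" if "i < n" for i
    using span_image_lessThan[OF f(3)[OF that]] by (auto simp: fun_eq_iff fun_scale_def)
  then obtain a where a: "\<And>i x. i < n \<Longrightarrow> ?L (f i) x - \<nu> i * f i x = (\<Sum>l<i. a i l * f l x)" by metis
  \<comment> \<open>Row \<open>i\<close> holds the coordinates of \<open>L (f i)\<close> in the
    basis \<open>f\<close>, hence lower triangular.\<close>
  define C where "C = Matrix.mat n n (\<lambda>(i, l). if l < i then a i l else if l = i then \<nu> i else 0)"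
  have C: "C \<in> carrier_mat n n" by (simp add: C_def)
  have M: "eval_mat n f z \<in> carrier_mat n n" by simp
  have CM: "(C * eval_mat n f z) $$ (i, j) = ?L (f i) (z j)" if ij: "i < n" "j < n" for i j
  proof -
    have "(C * eval_mat n f z) $$ (i, j) = (\<Sum>l<n. C $$ (i, l) * f l (z j))"
      using ij by (simp add: mat_mult_index[OF C M])
    also have "\<dots> = (\<Sum>l\<in>{..<Suc i}. C $$ (i, l) * f l (z j))"
      by (rule sum.mono_neutral_right) (use ij in \<open>auto simp: C_def\<close>)
    also have "\<dots> = (\<Sum>l<i. a i l * f l (z j)) + \<nu> i * f i (z j)"
      using ij by (simp add: C_def)
    also have "\<dots> = ?L (f i) (z j)" using a[OF ij(1), of "z j"] by (simp add: algebra_simps)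
    finally show ?thesis .
  qed
  have "G = N * (C * eval_mat n f z)"
  proof (rule eq_matI)
    fix k j assume "k < dim_row (N * (C * eval_mat n f z))" "j < dim_col (N * (C * eval_mat n f z))"
    then have kj: "k < n" "j < n" using N(1) by auto
    have "(N * (C * eval_mat n f z)) $$ (k, j) = (\<Sum>i<n. N $$ (k, i) * (C * eval_mat n f z) $$ (i, j))"
      using kj C by (intro mat_mult_index[OF N(1)]) auto
    then show "G $$ (k, j) = (N * (C * eval_mat n f z)) $$ (k, j)"
      using kj CM by (simp add: G_def)
  qed (use N(1) in \<open>auto simp: G_def\<close>)
  then have "det G = (\<Prod>i<n. C $$ (i, i))"
    using det_conjugated_triangular[OF M N(1) C N(2)] by (simp add: C_def)
  also have "\<dots> = (\<Prod>i<n. \<nu> i)" by (simp add: C_def)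
  finally show ?thesis using detG by simp
qed

section \<open>Eigenvalue bounds\<close>

text \<open>The degrees \<open>s\<close> are kept abstract, with only their counting property, so
  that the same bound serves the general exponent and the sharper one in dimension one.\<close>

lemma eigenvalue_bound:
  fixes D :: "(complex ^ 'n) set" and I :: "'i set"
    and T :: "'i \<Rightarrow> complex ^ 'n \<Rightarrow> complex ^ 'n" and w :: "'i \<Rightarrow> complex ^ 'n \<Rightarrow> complex"
  assumes T: "holomorphic_map_system D I T" and w: "holomorphic_weight_system D I w"
    and R: "R > 0" and D: "D = ball c R" and r: "0 < r" "r < 1"
    and img: "(\<Union>i\<in>I. T i ` D) \<subseteq> ball c (r * R)"
    and ev: "eigenvalue_sequence (U_space D) (transfer_operator D I T w) ev" and n: "n \<ge> 1"
  shows "\<exists>s. (\<forall>k<n. k < (s k + CARD('n)) choose CARD('n)) \<and>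
    norm (ev n) \<le> (SUP z\<in>D. \<Sum>\<^sub>\<infinity>i\<in>I. norm (w i z)) * sqrt n * r powr ((\<Sum>k<n. real (s k)) / n)"
proof -
  let ?W = "SUP z\<in>D. \<Sum>\<^sub>\<infinity>i\<in>I. norm (w i z)"
  interpret linear_operator_on "U_space D" "transfer_operator D I T w"
    by (rule linear_operator_on_transfer_operator[OF T w])
  have "c \<in> closure D" using R D by simp
  then have W0: "?W \<ge> 0" using weight_sum_le[OF T w, of c "{}"] by simp
  obtain q :: "nat \<Rightarrow> 'n multiset" where q: "\<And>k M. k < n \<Longrightarrow> size M < size (q k) \<Longrightarrow> \<exists>l<k. q l = M"
    "\<And>k. k < n \<Longrightarrow> k < (size (q k) + CARD('n)) choose CARD('n)"
    using exists_sorted_multisets[where ?'a = 'n and n = n] by blast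
  define N where "N = (\<Sum>k<n. size (q k))"
  have "norm (ev n) \<le> ?W * sqrt n * r powr (real N / n)"
  proof (cases "ev n = 0")
    case True
    then show ?thesis using W0 by simp
  next
    case False
    obtain f where f: "triangular (\<lambda>i. ev (Suc i)) f n"
      using eigenvalue_sequence_triangular[OF ev False order_refl] by blast
    have le: "norm (\<Prod>i<n. ev (Suc i)) \<le> (?W * K * sqrt n) ^ n * r ^ N" if "K > 1" for K
      unfolding N_def by (rule triangular_det_bound[OF T w R D r img f q(1) that])
    \<comment> \<open>The determinant bound holds for every \<open>K > 1\<close>; letting
      \<open>K\<close> decrease to 1 removes it.\<close>
    have "((\<lambda>K. (?W * K * sqrt n) ^ n * r ^ N) \<longlongrightarrow> (?W * 1 * sqrt n) ^ n * r ^ N) (at_right 1)"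
      by (intro tendsto_intros)
    then have "norm (\<Prod>i<n. ev (Suc i)) \<le> (?W * 1 * sqrt n) ^ n * r ^ N"
      by (rule tendsto_lowerbound) (use le in \<open>auto simp: eventually_at_right_less intro!: eventually_at_rightI[of 1 2]\<close>)
    \<comment> \<open>The \<open>n\<close>-th eigenvalue has the least modulus among the first
      \<open>n\<close>, so its \<open>n\<close>-th power is dominated by their product.\<close>
    moreover have "(\<Prod>i<n. norm (ev n)) \<le> (\<Prod>i<n. norm (ev (Suc i)))"
      by (rule prod_mono) (use ev in \<open>auto simp: eigenvalue_sequence_def\<close>)
    ultimately have "norm (ev n) ^ n \<le> (?W * sqrt n) ^ n * r ^ N" by (simp add: prod_norm)
    also have "r ^ N = (r powr (real N / n)) ^ n"
      using r n by (simp add: powr_realpow[symmetric] powr_powr)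
    finally have "norm (ev n) ^ n \<le> (?W * sqrt n * r powr (real N / n)) ^ n"
      by (simp only: power_mult_distrib)
    then show ?thesis
      by (rule iffD1[OF power_mono_iff, rotated 3]) (use W0 n in auto)
  qed
  then show ?thesis using q(2) unfolding N_def by (intro exI[of _ "\<lambda>k. size (q k)"]) simp
qed

theorem theorem3p2:
  fixes X D :: "(complex ^ 'n) set"
    and I :: "'i set"
    and T Te :: "'i \<Rightarrow> complex ^ 'n \<Rightarrow> complex ^ 'n"
    and w we :: "'i \<Rightarrow> complex ^ 'n \<Rightarrow> complex"
    and c :: "complex ^ 'n"
    and R r W :: real
    and d :: nat
    and ev :: "nat \<Rightarrow> complex"
  assumes "d = CARD('n)"
    and "compact X"
    and "Comega_map_weight_system X I T w"
    and "R > 0" and "D = ball c R"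
    and "map_system_extension X D I T Te"
    and "weight_system_extension X D I w we"
    and "0 < r" and "r < 1"
    and "(\<Union>i\<in>I. Te i ` D) \<subseteq> ball c (r * R)"
    and "W = (SUP z\<in>D. \<Sum>\<^sub>\<infinity>i\<in>I. norm (we i z))"
    and "eigenvalue_sequence (U_space D) (transfer_operator D I Te we) ev"
  shows "(W \<noteq> 0 \<longrightarrow>
            (\<forall>n\<ge>1. norm (ev n) <
               W / r ^ d * real n powr (1 / 2) *
               r powr (real d / (real d + 1) * fact d powr (1 / real d) * real n powr (1 / real d)))) \<and>
         (W = 0 \<longrightarrow>
            (\<forall>n\<ge>1. norm (ev n) \<le>
               W / r ^ d * real n powr (1 / 2) *
               r powr (real d / (real d + 1) * fact d powr (1 / real d) * real n powr (1 / real d)))) \<and>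
         (d = 1 \<longrightarrow>
            (\<forall>n\<ge>1. norm (ev n) \<le> W * real n powr (1 / 2) * r powr ((real n - 1) / 2)))"
proof -
  have T: "holomorphic_map_system D I Te" and w: "holomorphic_weight_system D I we"
    using assms unfolding map_system_extension_def weight_system_extension_def by auto
  note bound = eigenvalue_bound[OF T w assms(4,5,8,9,10,12), folded assms(1,11)]
  have powr_less: "r powr a < r powr b" if "b < a" for a b
    using assms(8,9) that by (simp add: powr_def)
  have d: "d \<ge> 1" using assms(1) by (simp add: Suc_leI)
  have "c \<in> closure D" using assms(4,5) by simp
  then have W0: "W \<ge> 0" using weight_sum_le[OF T w, of c "{}"] assms(11) by simp
  have strict: "norm (ev n) < W / r ^ d * real n powr (1 / 2) *
      r powr (real d / (real d + 1) * fact d powr (1 / real d) * real n powr (1 / real d))"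
    if n: "n \<ge> 1" and W: "W > 0" for n
  proof -
    let ?E = "real d / (real d + 1) * fact d powr (1 / real d) * real n powr (1 / real d)"
    obtain s where s: "\<And>k. k < n \<Longrightarrow> k < (s k + d) choose d"
      "norm (ev n) \<le> W * sqrt n * r powr ((\<Sum>k<n. real (s k)) / n)"
      using bound[OF n] by blast
    \<comment> \<open>The mean degree exceeds the claimed exponent less \<open>d\<close>; since
      \<open>r < 1\<close>, this \<open>d\<close> becomes the factor
      \<open>1 / r ^ d\<close>.\<close>
    have "?E - d < (\<Sum>k<n. real (s k)) / n"
      using sum_sizes_gt[OF s(1) d n] n by (simp add: pos_less_divide_eq mult.commute)
    then have "r powr ((\<Sum>k<n. real (s k)) / n) < r powr (?E - d)"
      by (rule powr_less)
    then have "W * sqrt n * r powr ((\<Sum>k<n. real (s k)) / n) < W * sqrt n * r powr (?E - d)"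
      using W n by (intro mult_strict_left_mono) auto
    also have "\<dots> = W / r ^ d * real n powr (1 / 2) * r powr ?E"
      using assms(8) by (simp add: powr_diff powr_realpow powr_half_sqrt)
    finally show ?thesis using s(2) by linarith
  qed
  \<comment> \<open>For \<open>W = 0\<close> the eigenvalue is 0 and so is the right-hand side,
    which rules out strict inequality.\<close>
  have zero: "norm (ev n) \<le> 0" if n: "n \<ge> 1" and W: "W = 0" for n
    using bound[OF n] W by auto
  have one: "norm (ev n) \<le> W * real n powr (1 / 2) * r powr ((real n - 1) / 2)" if n: "n \<ge> 1" and d1: "d = 1" for n
  proof -
    obtain s where s: "\<And>k. k < n \<Longrightarrow> k < (s k + d) choose d"
      "norm (ev n) \<le> W * sqrt n * r powr ((\<Sum>k<n. real (s k)) / n)"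
      using bound[OF n] by blast
    \<comment> \<open>In one variable the counting property reads \<open>k < s k + 1\<close>, so the
      degrees sum to at least that of 0 to \<open>n - 1\<close>.\<close>
    have "real n * (real n - 1) / 2 = (\<Sum>k<n. real k)"
      by (induction n) (auto simp: field_simps)
    also have "\<dots> \<le> (\<Sum>k<n. real (s k))"
      using s(1) d1 by (intro sum_mono) (auto simp: less_Suc_eq_le)
    finally have "(real n - 1) / 2 \<le> (\<Sum>k<n. real (s k)) / n"
      using n by (simp add: pos_le_divide_eq mult.commute)
    then have "r powr ((\<Sum>k<n. real (s k)) / n) \<le> r powr ((real n - 1) / 2)"
      using powr_less by (cases "(real n - 1) / 2 = (\<Sum>k<n. real (s k)) / n") (auto simp: less_eq_real_def)
    then have "W * sqrt n * r powr ((\<Sum>k<n. real (s k)) / n) \<le> W * sqrt n * r powr ((real n - 1) / 2)"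
      using W0 by (intro mult_left_mono) auto
    with s(2) show ?thesis by (simp add: powr_half_sqrt)
  qed
  show ?thesis
    using strict zero one W0 by (auto simp: less_le)
qed

end
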